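(* There exists an infinitely generated torsion-free Fuchsian group $\Gamma<\mathrm{Isom}^+(\mathbb{H})$ such that ${\rm HD}(\Lambda^\tau_\Gamma)=0$.
   Context: $\mathbb{H}$ is the hyperbolic plane, with boundary at infinity $\partial_\infty\mathbb{H}$. Fix $o\in\mathbb{H}$. The limit set is $\Lambda_\Gamma=\overline{\Gamma\cdot o}\setminus\Gamma\cdot o$. For $\xi\in\partial_\infty\mathbb{H}$ let $\xi_t$ be the point of the geodesic ray $[o,\xi)$ at distance $t$ from $o$ and $\Delta(\xi_t)=d(\xi_t,\Gamma\cdot o)$. The transient limit set is $\Lambda^\tau_\Gamma=\{\xi\in\Lambda_\Gamma:\lim_{t\to\infty}\Delta(\xi_t)=\infty\}$. Hausdorff dimension is taken with respect to a visual metric on the boundary (equivalently, the Euclidean metric on $\mathbb{R}$ in the upper half-plane model, locally). *)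

theory Defs
  imports "HOL-Analysis.Analysis"
begin

definition uhp :: "complex set" where
  "uhp = {z. Im z > 0}"

definition hdist :: "complex \<Rightarrow> complex \<Rightarrow> real" where
  "hdist z w = arcosh (1 + (cmod (z - w))^2 / (2 * Im z * Im w))"

section \<open>Isom+(H) = PSL(2,R); groups represented by their full preimage in SL(2,R)\<close>

type_synonym mat2 = "real^2^2"

definition SL2 :: "mat2 set" where
  "SL2 = {A. det A = 1}"

definition act :: "mat2 \<Rightarrow> complex \<Rightarrow> complex" where
  "act A z = (of_real (A$1$1) * z + of_real (A$1$2)) / (of_real (A$2$1) * z + of_real (A$2$2))"

definition sl2_subgroup :: "mat2 set \<Rightarrow> bool" where
  "sl2_subgroup G \<longleftrightarrow> G \<subseteq> SL2 \<and> mat 1 \<in> G \<and>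
     (\<forall>A\<in>G. \<forall>B\<in>G. A ** B \<in> G) \<and> (\<forall>A\<in>G. matrix_inv A \<in> G)"

definition sl2_generated :: "mat2 set \<Rightarrow> mat2 set" where
  "sl2_generated S = \<Inter>{H. sl2_subgroup H \<and> S \<subseteq> H}"

fun mpow :: "mat2 \<Rightarrow> nat \<Rightarrow> mat2" where
  "mpow A 0 = mat 1"
| "mpow A (Suc n) = A ** mpow A n"

text \<open>A subgroup \<open>\<Gamma>\<close> of PSL(2,R) is represented by its preimage \<open>G\<close> in SL(2,R),
  i.e. a subgroup of SL(2,R) containing \<open>-I\<close>.\<close>
definition psl2_subgroup :: "mat2 set \<Rightarrow> bool" where
  "psl2_subgroup G \<longleftrightarrow> sl2_subgroup G \<and> - mat 1 \<in> G"

definition fuchsian :: "mat2 set \<Rightarrow> bool" where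
  "fuchsian G \<longleftrightarrow> psl2_subgroup G \<and>
     (\<exists>\<epsilon>>0. \<forall>A\<in>G. A \<noteq> mat 1 \<longrightarrow> norm (A - mat 1) \<ge> \<epsilon>)"

text \<open>Torsion-free as a subgroup of PSL(2,R): no nontrivial element of finite order.\<close>
definition torsion_free :: "mat2 set \<Rightarrow> bool" where
  "torsion_free G \<longleftrightarrow> (\<forall>A\<in>G. \<forall>n>0. mpow A n \<in> {mat 1, - mat 1} \<longrightarrow> A \<in> {mat 1, - mat 1})"

text \<open>Finitely generated (as G contains -I, equivalent to finite generation of G/{+-I}).\<close>
definition finitely_generated :: "mat2 set \<Rightarrow> bool" where
  "finitely_generated G \<longleftrightarrow> (\<exists>S. finite S \<and> G = sl2_generated S)"

section \<open>Boundary at infinity: R \<union> {\<infinity>}, with None = \<infinity>\<close>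

type_synonym bdry = "real option"

definition conv_bdry :: "'b filter \<Rightarrow> ('b \<Rightarrow> complex) \<Rightarrow> bdry \<Rightarrow> bool" where
  "conv_bdry F f \<xi> = (case \<xi> of
      None \<Rightarrow> filterlim (\<lambda>t. cmod (f t)) at_top F
    | Some x \<Rightarrow> (f \<longlongrightarrow> complex_of_real x) F)"

definition orbit :: "mat2 set \<Rightarrow> complex \<Rightarrow> complex set" where
  "orbit G x0 = (\<lambda>A. act A x0) ` G"

definition limit_set :: "mat2 set \<Rightarrow> complex \<Rightarrow> bdry set" where
  "limit_set G x0 = {\<xi>. \<exists>p::nat \<Rightarrow> complex. (\<forall>n. p n \<in> orbit G x0) \<and> conv_bdry sequentially p \<xi>}"

definition orbit_dist :: "mat2 set \<Rightarrow> complex \<Rightarrow> complex \<Rightarrow> real" where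
  "orbit_dist G x0 p = Inf ((\<lambda>q. hdist p q) ` orbit G x0)"

definition geodesic_ray :: "complex \<Rightarrow> (real \<Rightarrow> complex) \<Rightarrow> bool" where
  "geodesic_ray x0 r \<longleftrightarrow> r 0 = x0 \<and> (\<forall>t\<ge>0. r t \<in> uhp) \<and>
     (\<forall>s\<ge>0. \<forall>t\<ge>0. hdist (r s) (r t) = \<bar>s - t\<bar>)"

definition transient_limit_set :: "mat2 set \<Rightarrow> complex \<Rightarrow> bdry set" where
  "transient_limit_set G x0 = {\<xi> \<in> limit_set G x0. \<forall>r. geodesic_ray x0 r \<and> conv_bdry at_top r \<xi> \<longrightarrow>
      filterlim (\<lambda>t. orbit_dist G x0 (r t)) at_top at_top}"

definition hausdorff_pre :: "real \<Rightarrow> real \<Rightarrow> real set \<Rightarrow> ennreal" where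
  "hausdorff_pre s \<delta> A = (INF U \<in> {U :: nat \<Rightarrow> real set. A \<subseteq> (\<Union>i. U i) \<and>
        (\<forall>i. bounded (U i) \<and> diameter (U i) \<le> \<delta>)}.
      (\<Sum>i. ennreal (diameter (U i) powr s)))"

definition hausdorff_measure :: "real \<Rightarrow> real set \<Rightarrow> ennreal" where
  "hausdorff_measure s A = (SUP \<delta> \<in> {0<..}. hausdorff_pre s \<delta> A)"

definition hausdorff_dim :: "real set \<Rightarrow> real" where
  "hausdorff_dim A = Inf {s. s > 0 \<and> hausdorff_measure s A = 0}"

text \<open>Hausdorff dimension of a subset of the boundary: of its finite part in R
  (the point \<infinity> does not affect the dimension).\<close>
definition bdry_hausdorff_dim :: "bdry set \<Rightarrow> real" where
  "bdry_hausdorff_dim X = hausdorff_dim {x. Some x \<in> X}"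

end

theory Submission
  imports Defs
begin

text \<open>
  The group is an infinitely generated Schottky group inside the level-2 congruence subgroup, so it is
  discrete and torsion-free; ping-pong on disjoint discs accumulating only at infinity shows that it is
  not finitely generated. A finite limit point either is in the orbit of infinity or has an infinite
  itinerary \<open>l\<^sub>0, l\<^sub>1, \<dots>\<close> of generators. If some letter occurs infinitely often, the geodesic
  ray returns infinitely often to a bounded part of the quotient. Hence for every finite set \<open>F\<close> of
  generators a transient limit point is, up to countably many points, a translate of a point whose
  itinerary avoids \<open>F\<close>. The generators contract their discs by factors that are summable to any power
  \<open>s > 0\<close>, so once \<open>F\<close> is large the self-similar set of the latter points has vanishing
  \<open>s\<close>-dimensional Hausdorff content.
\<close>

section \<open>Hausdorff content\<close>

definition hausdorff_content :: "real \<Rightarrow> 'a::metric_space set \<Rightarrow> ennreal" where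
  "hausdorff_content s X =
     (INF U \<in> {U :: nat \<Rightarrow> 'a set. X \<subseteq> (\<Union>i. U i) \<and> (\<forall>i. bounded (U i))}.
        \<Sum>i. ennreal (diameter (U i) powr s))"

lemma hausdorff_content_le:
  fixes U :: "nat \<Rightarrow> 'a::metric_space set"
  assumes "X \<subseteq> (\<Union>i. U i)" "\<And>i. bounded (U i)"
  shows "hausdorff_content s X \<le> (\<Sum>i. ennreal (diameter (U i) powr s))"
  unfolding hausdorff_content_def using assms by (intro INF_lower) auto

lemma hausdorff_content_cover:
  fixes X :: "'a::metric_space set"
  assumes "hausdorff_content s X < \<infinity>" "0 < \<epsilon>"
  shows "\<exists>U :: nat \<Rightarrow> 'a set. X \<subseteq> (\<Union>i. U i) \<and> (\<forall>i. bounded (U i)) \<and>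
    (\<Sum>i. ennreal (diameter (U i) powr s)) < hausdorff_content s X + ennreal \<epsilon>"
proof -
  have "hausdorff_content s X < hausdorff_content s X + ennreal \<epsilon>"
    using assms by (simp add: ennreal_add_left_cancel_less)
  then show ?thesis
    unfolding hausdorff_content_def[of s X] INF_less_iff by auto
qed

lemma hausdorff_content_mono:
  assumes "X \<subseteq> Y"
  shows "hausdorff_content s X \<le> hausdorff_content s Y"
  unfolding hausdorff_content_def using assms by (intro INF_superset_mono) auto

lemma hausdorff_content_eq_0_subset:
  assumes "hausdorff_content s Y = 0" "X \<subseteq> Y"
  shows "hausdorff_content s X = 0"
  using hausdorff_content_mono[OF assms(2), of s] assms(1) by simp

lemma hausdorff_content_countable:
  assumes "countable X"
  shows "hausdorff_content s X = 0"
proof -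
  have "X \<subseteq> (\<Union>n. {from_nat_into X n})"
    using from_nat_into_surj[OF assms] by auto
  from hausdorff_content_le[OF this, of s] show ?thesis
    by simp
qed

lemma hausdorff_content_le_diameter:
  assumes "bounded X"
  shows "hausdorff_content s X \<le> ennreal (diameter X powr s)"
proof -
  have "hausdorff_content s X \<le> (\<Sum>i. ennreal (diameter (if i = 0 then X else {}) powr s))"
    by (rule hausdorff_content_le) (use assms in \<open>auto split: if_splits\<close>)
  also have "\<dots> = ennreal (diameter X powr s)"
    by (subst suminf_finite[of "{0}"]) auto
  finally show ?thesis .
qed

lemma suminf_prod_decode_ennreal:
  fixes h :: "nat \<Rightarrow> nat \<Rightarrow> ennreal"
  shows "(\<Sum>k. case_prod h (prod_decode k)) = (\<Sum>n. \<Sum>i. h n i)"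
  using suminf_ennreal_2dimen[of "\<lambda>n. \<Sum>i. h n i" "case_prod h"] by (simp add: o_def)

lemma hausdorff_content_UN_le_suminf:
  fixes U :: "nat \<Rightarrow> nat \<Rightarrow> 'a::metric_space set"
  assumes cover: "\<And>n. X n \<subseteq> (\<Union>i. U n i)" and bdd: "\<And>n i. bounded (U n i)"
  shows "hausdorff_content s (\<Union>n. X n) \<le> (\<Sum>n. \<Sum>i. ennreal (diameter (U n i) powr s))"
proof -
  define V where "V k = case_prod U (prod_decode k)" for k
  have "X n \<subseteq> (\<Union>k. V k)" for n
  proof
    fix x assume "x \<in> X n"
    then obtain i where "x \<in> U n i" using cover by blast
    then have "x \<in> V (prod_encode (n, i))" by (simp add: V_def)
    then show "x \<in> (\<Union>k. V k)" by blast
  qed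
  then have "hausdorff_content s (\<Union>n. X n) \<le> (\<Sum>k. ennreal (diameter (V k) powr s))"
    by (intro hausdorff_content_le) (auto simp: V_def bdd split: prod.split)
  also have "\<dots> = (\<Sum>n. \<Sum>i. ennreal (diameter (U n i) powr s))"
    unfolding suminf_prod_decode_ennreal[symmetric]
    by (intro suminf_cong) (simp add: V_def split: prod.split)
  finally show ?thesis .
qed

lemma hausdorff_content_UN_nat:
  fixes X :: "nat \<Rightarrow> 'a::metric_space set"
  shows "hausdorff_content s (\<Union>n. X n) \<le> (\<Sum>n. hausdorff_content s (X n))"
proof (cases "(\<Sum>n. hausdorff_content s (X n)) < \<infinity>")
  case True
  then have finite_content: "hausdorff_content s (X n) < \<infinity>" for n
    using ennreal_suminf_lessD by fastforce
  show ?thesis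
  proof (rule ennreal_le_epsilon)
    fix \<epsilon> :: real assume "0 < \<epsilon>"
    let ?\<epsilon> = "\<lambda>n. \<epsilon> * (1/2)^Suc n"
    have "\<exists>U. X n \<subseteq> (\<Union>i::nat. U i) \<and> (\<forall>i. bounded (U i)) \<and>
        (\<Sum>i. ennreal (diameter (U i) powr s)) < hausdorff_content s (X n) + ennreal (?\<epsilon> n)" for n
      using \<open>0 < \<epsilon>\<close> by (intro hausdorff_content_cover finite_content) simp
    then obtain U :: "nat \<Rightarrow> nat \<Rightarrow> 'a set"
      where cover: "\<And>n. X n \<subseteq> (\<Union>i. U n i)" "\<And>n i. bounded (U n i)"
        and cost: "\<And>n. (\<Sum>i. ennreal (diameter (U n i) powr s))
          < hausdorff_content s (X n) + ennreal (?\<epsilon> n)"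
      by metis
    have "hausdorff_content s (\<Union>n. X n) \<le> (\<Sum>n. \<Sum>i. ennreal (diameter (U n i) powr s))"
      using cover by (rule hausdorff_content_UN_le_suminf)
    also have "\<dots> \<le> (\<Sum>n. hausdorff_content s (X n) + ennreal (?\<epsilon> n))"
      by (intro suminf_le less_imp_le cost) auto
    also have "\<dots> = (\<Sum>n. hausdorff_content s (X n)) + (\<Sum>n. ennreal (?\<epsilon> n))"
      by (intro suminf_add[symmetric]) auto
    also have "(\<Sum>n. ennreal (?\<epsilon> n)) = ennreal \<epsilon>"
      using sums_mult[OF power_half_series, of \<epsilon>] \<open>0 < \<epsilon>\<close> by (intro suminf_ennreal_eq) auto
    finally show "hausdorff_content s (\<Union>n. X n) \<le> (\<Sum>n. hausdorff_content s (X n)) + ennreal \<epsilon>" .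
  qed
next
  case False
  then show ?thesis by (simp add: not_less top_unique)
qed

lemma hausdorff_content_UN:
  assumes "countable I"
  shows "hausdorff_content s (\<Union>i\<in>I. X i) \<le> (\<integral>\<^sup>+i. hausdorff_content s (X i) \<partial>count_space I)"
proof -
  define enum where "enum = to_nat_on I"
  define Y where "Y n = (\<Union>i\<in>{i\<in>I. enum i = n}. X i)" for n
  have inj: "inj_on enum I"
    unfolding enum_def by (rule inj_on_to_nat_on[OF assms])
  have Y_enum: "Y (enum i) = X i" if "i \<in> I" for i
  proof -
    have "{i'\<in>I. enum i' = enum i} = {i}"
      using inj that by (auto dest: inj_onD)
    then show ?thesis by (simp add: Y_def)
  qed
  have Y_empty: "Y n = {}" if "n \<notin> enum ` I" for n
    using that by (auto simp: Y_def)
  have "hausdorff_content s (\<Union>i\<in>I. X i) \<le> hausdorff_content s (\<Union>n. Y n)"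
    by (rule hausdorff_content_mono) (auto simp: Y_def)
  also have "\<dots> \<le> (\<integral>\<^sup>+n. hausdorff_content s (Y n) \<partial>count_space UNIV)"
    unfolding nn_integral_count_space_nat by (rule hausdorff_content_UN_nat)
  also have "\<dots> = (\<integral>\<^sup>+n. hausdorff_content s (Y n) \<partial>count_space (enum ` I))"
    by (rule nn_integral_count_space_eq) (auto simp: Y_empty hausdorff_content_countable)
  also have "\<dots> = (\<integral>\<^sup>+i. hausdorff_content s (Y (enum i)) \<partial>count_space I)"
    by (rule nn_integral_bij_count_space[symmetric]) (simp add: bij_betw_def inj)
  also have "\<dots> = (\<integral>\<^sup>+i. hausdorff_content s (X i) \<partial>count_space I)"
    by (rule nn_integral_cong) (simp add: Y_enum)
  finally show ?thesis .
qed

lemma hausdorff_content_UN_eq_0: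
  assumes "countable I" "\<And>i. i \<in> I \<Longrightarrow> hausdorff_content s (X i) = 0"
  shows "hausdorff_content s (\<Union>i\<in>I. X i) = 0"
proof -
  have "(\<integral>\<^sup>+i. hausdorff_content s (X i) \<partial>count_space I) = 0"
    using assms(2) by (simp add: nn_integral_0_iff_AE AE_count_space)
  with hausdorff_content_UN[OF assms(1), of s X] show ?thesis by simp
qed

lemma hausdorff_content_Un_eq_0:
  assumes "hausdorff_content s X = 0" "hausdorff_content s Y = 0"
  shows "hausdorff_content s (X \<union> Y) = 0"
  using hausdorff_content_UN_eq_0[of "{X, Y}" s "\<lambda>Z. Z"] assms by auto

lemma
  fixes f :: "'a::metric_space \<Rightarrow> 'b::metric_space"
  assumes "\<rho>-lipschitz_on X f" "bounded U" "X \<subseteq> U"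
  shows bounded_lipschitz_image: "bounded (f ` X)"
    and diameter_lipschitz_image_le: "diameter (f ` X) \<le> \<rho> * diameter U"
proof -
  have dist_le: "dist (f x) (f y) \<le> \<rho> * diameter U" if "x \<in> X" "y \<in> X" for x y
  proof -
    have "dist (f x) (f y) \<le> \<rho> * dist x y"
      using lipschitz_onD[OF assms(1) that] .
    also have "\<dots> \<le> \<rho> * diameter U"
      using diameter_bounded_bound[OF assms(2)] that assms(3) lipschitz_on_nonneg[OF assms(1)]
      by (intro mult_left_mono) auto
    finally show ?thesis .
  qed
  then show "bounded (f ` X)"
    unfolding bounded_two_points by blast
  show "diameter (f ` X) \<le> \<rho> * diameter U"
  proof (cases "X = {}")
    case True
    then show ?thesis
      using diameter_ge_0[OF assms(2)] lipschitz_on_nonneg[OF assms(1)] by simp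
  next
    case False
    then have "(SUP (u, v)\<in>f ` X \<times> f ` X. dist u v) \<le> \<rho> * diameter U"
      by (intro cSUP_least) (auto intro: dist_le)
    with False show ?thesis
      by (simp add: diameter_def)
  qed
qed

lemma diameter_powr_lipschitz_image_le:
  fixes f :: "'a::metric_space \<Rightarrow> 'b::metric_space"
  assumes "\<rho>-lipschitz_on X f" "bounded U" "X \<subseteq> U" "0 \<le> s"
  shows "diameter (f ` X) powr s \<le> \<rho> powr s * diameter U powr s"
proof -
  have "diameter (f ` X) powr s \<le> (\<rho> * diameter U) powr s"
    using diameter_ge_0[OF bounded_lipschitz_image[OF assms(1-3)]]
      diameter_lipschitz_image_le[OF assms(1-3)] assms(4)
    by (intro powr_mono2) auto
  also have "\<dots> = \<rho> powr s * diameter U powr s"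
    using lipschitz_on_nonneg[OF assms(1)] diameter_ge_0[OF assms(2)] by (simp add: powr_mult)
  finally show ?thesis .
qed

lemma hausdorff_content_lipschitz_image:
  fixes f :: "'a::metric_space \<Rightarrow> 'b::metric_space"
  assumes lipschitz: "\<rho>-lipschitz_on X f" and "0 < \<rho>" "0 \<le> s"
  shows "hausdorff_content s (f ` X) \<le> ennreal (\<rho> powr s) * hausdorff_content s X"
proof (cases "hausdorff_content s X < \<infinity>")
  case True
  let ?c = "\<rho> powr s"
  have "0 < ?c" using \<open>0 < \<rho>\<close> by simp
  show ?thesis
  proof (rule ennreal_le_epsilon)
    fix \<epsilon> :: real assume "0 < \<epsilon>"
    then have "0 < \<epsilon> / ?c" using \<open>0 < ?c\<close> by simp
    then obtain U :: "nat \<Rightarrow> 'a set"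
      where cover: "X \<subseteq> (\<Union>i. U i)" and bdd: "\<And>i. bounded (U i)"
        and cost: "(\<Sum>i. ennreal (diameter (U i) powr s)) < hausdorff_content s X + ennreal (\<epsilon> / ?c)"
      using hausdorff_content_cover[OF True] by blast
    have lipschitz_U: "\<rho>-lipschitz_on (X \<inter> U i) f" for i
      using lipschitz by (rule lipschitz_on_subset) blast
    have "f ` X \<subseteq> (\<Union>i. f ` (X \<inter> U i))"
      using cover by blast
    then have "hausdorff_content s (f ` X) \<le> (\<Sum>i. ennreal (diameter (f ` (X \<inter> U i)) powr s))"
      using bounded_lipschitz_image[OF lipschitz_U bdd Int_lower2] by (rule hausdorff_content_le)
    also have "\<dots> \<le> (\<Sum>i. ennreal ?c * ennreal (diameter (U i) powr s))"
      using diameter_powr_lipschitz_image_le[OF lipschitz_U bdd Int_lower2 \<open>0 \<le> s\<close>]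
      by (intro suminf_le) (simp_all add: ennreal_leI flip: ennreal_mult)
    also have "\<dots> \<le> ennreal ?c * (hausdorff_content s X + ennreal (\<epsilon> / ?c))"
      using cost by (simp add: mult_left_mono)
    also have "\<dots> = ennreal ?c * hausdorff_content s X + ennreal \<epsilon>"
      using \<open>0 < \<epsilon>\<close> \<open>0 < ?c\<close> by (simp add: distrib_left flip: ennreal_mult)
    finally show "hausdorff_content s (f ` X) \<le> ennreal ?c * hausdorff_content s X + ennreal \<epsilon>" .
  qed
next
  case False
  then show ?thesis
    using \<open>0 < \<rho>\<close> by (simp add: not_less top_unique ennreal_mult_top)
qed

lemma hausdorff_content_lipschitz_image_eq_0:
  fixes f :: "'a::metric_space \<Rightarrow> 'b::metric_space"
  assumes "\<rho>-lipschitz_on X f" "0 < \<rho>" "0 \<le> s" "hausdorff_content s X = 0"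
  shows "hausdorff_content s (f ` X) = 0"
  using hausdorff_content_lipschitz_image[OF assms(1-3)] assms(4) by simp

text \<open>Subadditivity bounds the content of such a set by a proper fraction of itself.\<close>
lemma hausdorff_content_self_cover_eq_0:
  fixes X :: "'a::metric_space set"
  assumes "0 \<le> s" "countable I" and finite_content: "hausdorff_content s X < \<infinity>"
    and self_cover: "X \<subseteq> (\<Union>i\<in>I. f i ` (X \<inter> F i))"
    and lipschitz: "\<And>i. i \<in> I \<Longrightarrow> (\<rho> i)-lipschitz_on (F i) (f i)" "\<And>i. i \<in> I \<Longrightarrow> 0 < \<rho> i"
    and contracting: "(\<integral>\<^sup>+i. ennreal (\<rho> i powr s) \<partial>count_space I) < 1"
  shows "hausdorff_content s X = 0"
proof (rule ccontr)
  let ?r = "\<integral>\<^sup>+i. ennreal (\<rho> i powr s) \<partial>count_space I"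
  assume "hausdorff_content s X \<noteq> 0"
  have "hausdorff_content s X \<le> hausdorff_content s (\<Union>i\<in>I. f i ` (X \<inter> F i))"
    by (rule hausdorff_content_mono[OF self_cover])
  also have "\<dots> \<le> (\<integral>\<^sup>+i. hausdorff_content s (f i ` (X \<inter> F i)) \<partial>count_space I)"
    by (rule hausdorff_content_UN[OF \<open>countable I\<close>])
  also have "\<dots> \<le> (\<integral>\<^sup>+i. ennreal (\<rho> i powr s) * hausdorff_content s X \<partial>count_space I)"
  proof (rule nn_integral_mono, unfold space_count_space)
    fix i assume "i \<in> I"
    have "hausdorff_content s (f i ` (X \<inter> F i)) \<le> ennreal (\<rho> i powr s) * hausdorff_content s (X \<inter> F i)"
      using lipschitz[OF \<open>i \<in> I\<close>] \<open>0 \<le> s\<close>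
      by (intro hausdorff_content_lipschitz_image) (auto intro: lipschitz_on_subset)
    also have "\<dots> \<le> ennreal (\<rho> i powr s) * hausdorff_content s X"
      by (intro mult_left_mono hausdorff_content_mono) auto
    finally show "hausdorff_content s (f i ` (X \<inter> F i))
        \<le> ennreal (\<rho> i powr s) * hausdorff_content s X" .
  qed
  also have "\<dots> = ?r * hausdorff_content s X"
    by (rule nn_integral_multc) simp
  also have "\<dots> < 1 * hausdorff_content s X"
    using contracting finite_content \<open>hausdorff_content s X \<noteq> 0\<close>
    by (intro ennreal_mult_strict_right_mono) (auto simp: zero_less_iff_neq_zero)
  finally show False by simp
qed

lemma hausdorff_measure_eq_0:
  assumes "0 < s" "hausdorff_content s X = 0"
  shows "hausdorff_measure s X = 0"
proof -
  have "hausdorff_pre s \<delta> X \<le> 0 + ennreal \<epsilon>" if "0 < \<delta>" "0 < \<epsilon>" for \<delta> \<epsilon>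
  proof -
    have "hausdorff_content s X < \<infinity>" "0 < min \<epsilon> (\<delta> powr s)"
      using assms(2) that by simp_all
    from hausdorff_content_cover[OF this] obtain U :: "nat \<Rightarrow> real set"
      where cover: "X \<subseteq> (\<Union>i. U i)" "\<And>i. bounded (U i)"
      and "(\<Sum>i. ennreal (diameter (U i) powr s)) < hausdorff_content s X + ennreal (min \<epsilon> (\<delta> powr s))"
      by blast
    then have cost: "(\<Sum>i. ennreal (diameter (U i) powr s)) < ennreal (min \<epsilon> (\<delta> powr s))"
      by (simp add: assms(2))
    have "diameter (U i) \<le> \<delta>" for i
    proof -
      have "ennreal (diameter (U i) powr s) \<le> (\<Sum>i. ennreal (diameter (U i) powr s))"
        by (rule order_trans[OF _ sum_le_suminf[of _ "{i}"]]) auto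
      also have "\<dots> \<le> ennreal (\<delta> powr s)"
        by (rule order_trans[OF less_imp_le[OF cost]]) (intro ennreal_leI min.cobounded2)
      finally have "diameter (U i) powr s \<le> \<delta> powr s" by simp
      then show ?thesis
        using powr_less_mono2[OF \<open>0 < s\<close>, of \<delta> "diameter (U i)"] \<open>0 < \<delta>\<close> by linarith
    qed
    then have "hausdorff_pre s \<delta> X \<le> (\<Sum>i. ennreal (diameter (U i) powr s))"
      unfolding hausdorff_pre_def using cover by (intro INF_lower) auto
    also have "\<dots> \<le> 0 + ennreal \<epsilon>"
      unfolding add_0 by (rule order_trans[OF less_imp_le[OF cost]]) (intro ennreal_leI min.cobounded1)
    finally show ?thesis .
  qed
  then have "hausdorff_pre s \<delta> X = 0" if "0 < \<delta>" for \<delta>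
    using ennreal_le_epsilon[of 0 "hausdorff_pre s \<delta> X"] that by fastforce
  then show ?thesis
    unfolding hausdorff_measure_def by (simp add: SUP_eq_const)
qed

lemma hausdorff_dim_eq_0:
  assumes "\<And>s. 0 < s \<Longrightarrow> hausdorff_content s X = 0"
  shows "hausdorff_dim X = 0"
proof -
  have "{s. s > 0 \<and> hausdorff_measure s X = 0} = {0<..}"
    using assms hausdorff_measure_eq_0 by auto
  then show ?thesis unfolding hausdorff_dim_def by simp
qed

lemma nn_integral_count_space_small_tail:
  fixes f :: "'a \<Rightarrow> real"
  assumes summable: "f summable_on A" and nonneg: "\<And>x. x \<in> A \<Longrightarrow> 0 \<le> f x" and "0 < \<epsilon>"
  obtains F where "finite F" "F \<subseteq> A" "(\<integral>\<^sup>+x. ennreal (f x) \<partial>count_space (A - F)) < ennreal \<epsilon>"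
proof -
  have "(sum f \<longlongrightarrow> infsum f A) (finite_subsets_at_top A)"
    using has_sum_infsum[OF summable] by (simp add: has_sum_def)
  then have "\<forall>\<^sub>F F in finite_subsets_at_top A. dist (sum f F) (infsum f A) < \<epsilon>"
    using \<open>0 < \<epsilon>\<close> by (rule tendstoD)
  then obtain F where F: "finite F" "F \<subseteq> A" "dist (sum f F) (infsum f A) < \<epsilon>"
    by (auto simp: eventually_finite_subsets_at_top)
  have tail: "f summable_on (A - F)" "infsum f (A - F) = infsum f A - sum f F"
    using F summable by (auto simp: infsum_Diff intro: summable_on_Diff)
  then have abs_summable: "Infinite_Set_Sum.abs_summable_on f (A - F)"
    using summable_on_iff_abs_summable_on_real abs_summable_equivalent by blast
  have "(\<integral>\<^sup>+x. ennreal (f x) \<partial>count_space (A - F)) = ennreal (infsetsum f (A - F))"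
    using abs_summable nonneg by (intro nn_integral_conv_infsetsum) auto
  also have "\<dots> = ennreal (infsum f (A - F))"
    by (simp add: infsetsum_infsum[OF abs_summable])
  also have "\<dots> < ennreal \<epsilon>"
    using F(3) \<open>0 < \<epsilon>\<close> unfolding tail(2) by (intro ennreal_lessI) (auto simp: dist_real_def)
  finally show thesis
    by (rule that[OF F(1,2)])
qed

section \<open>Moebius transformations\<close>

definition mk2 :: "real \<Rightarrow> real \<Rightarrow> real \<Rightarrow> real \<Rightarrow> mat2" where
  "mk2 a b c d = vector [vector [a, b], vector [c, d]]"

lemma mk2_nth [simp]:
  "mk2 a b c d $ 1 $ 1 = a" "mk2 a b c d $ 1 $ 2 = b"
  "mk2 a b c d $ 2 $ 1 = c" "mk2 a b c d $ 2 $ 2 = d"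
  by (simp_all add: mk2_def)

lemma mat2_eq_iff:
  fixes A B :: mat2
  shows "A = B \<longleftrightarrow> A$1$1 = B$1$1 \<and> A$1$2 = B$1$2 \<and> A$2$1 = B$2$1 \<and> A$2$2 = B$2$2"
  by (auto simp: vec_eq_iff forall_2)

lemma mat_1_nth [simp]:
  "(mat 1 :: mat2) $ 1 $ 1 = 1" "(mat 1 :: mat2) $ 1 $ 2 = 0"
  "(mat 1 :: mat2) $ 2 $ 1 = 0" "(mat 1 :: mat2) $ 2 $ 2 = 1"
  by (simp_all add: mat_def)

lemma mat2_mult_nth:
  fixes A B :: mat2
  shows "(A ** B) $ i $ j = A$i$1 * B$1$j + A$i$2 * B$2$j"
  by (simp add: matrix_matrix_mult_def sum_2)

lemma
  fixes A :: "'a::ring_1^'n^'m" and B :: "'a^'k^'n"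
  shows matrix_mult_uminus_left: "(- A) ** B = - (A ** B)"
    and matrix_mult_uminus_right: "A ** (- B) = - (A ** B)"
  by (simp_all add: matrix_matrix_mult_def vec_eq_iff sum_negf)

lemma matrix_inv_unique:
  fixes A B :: "'a::field^'n^'n"
  assumes "A ** B = mat 1"
  shows "matrix_inv A = B"
proof -
  have "B ** A = mat 1"
    using assms matrix_left_right_inverse by blast
  then have "A ** matrix_inv A = mat 1"
    using assms unfolding matrix_inv_def by (metis (mono_tags, lifting) someI_ex)
  then have "B ** A ** matrix_inv A = B"
    by (simp flip: matrix_mul_assoc)
  then show ?thesis
    by (simp add: \<open>B ** A = mat 1\<close>)
qed

lemma mem_SL2_iff: "A \<in> SL2 \<longleftrightarrow> A$1$1 * A$2$2 - A$1$2 * A$2$1 = 1"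
  by (simp add: SL2_def det_2)

lemma SL2_mult: "A \<in> SL2 \<Longrightarrow> B \<in> SL2 \<Longrightarrow> A ** B \<in> SL2"
  by (simp add: SL2_def det_mul)

lemma SL2_uminus: "- A \<in> SL2 \<longleftrightarrow> A \<in> SL2"
  by (simp add: mem_SL2_iff)

lemma SL2_mat_1: "mat 1 \<in> SL2"
  by (simp add: SL2_def)

lemma matrix_inv_SL2:
  assumes "A \<in> SL2"
  shows "matrix_inv A = mk2 (A$2$2) (- A$1$2) (- A$2$1) (A$1$1)"
  using assms
  by (intro matrix_inv_unique) (simp add: mat2_eq_iff mat2_mult_nth mem_SL2_iff algebra_simps)

lemma
  assumes "A \<in> SL2"
  shows SL2_matrix_inv: "matrix_inv A \<in> SL2"
    and matrix_inv_left_SL2: "matrix_inv A ** A = mat 1"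
    and matrix_inv_right_SL2: "A ** matrix_inv A = mat 1"
    and matrix_inv_matrix_inv_SL2: "matrix_inv (matrix_inv A) = A"
proof -
  show "matrix_inv A \<in> SL2" "matrix_inv A ** A = mat 1" "A ** matrix_inv A = mat 1"
    using assms unfolding matrix_inv_SL2[OF assms]
    by (simp_all add: mat2_eq_iff mat2_mult_nth mem_SL2_iff algebra_simps)
  then show "matrix_inv (matrix_inv A) = A"
    by (intro matrix_inv_unique)
qed

definition denom :: "mat2 \<Rightarrow> 'a::real_field \<Rightarrow> 'a" where
  "denom A z = of_real (A$2$1) * z + of_real (A$2$2)"

definition moebius :: "mat2 \<Rightarrow> 'a::real_field \<Rightarrow> 'a" where
  "moebius A z = (of_real (A$1$1) * z + of_real (A$1$2)) / denom A z"

lemma act_eq_moebius: "act = moebius"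
  by (simp add: fun_eq_iff act_def moebius_def denom_def)

lemma denom_of_real: "denom A (of_real x) = of_real (denom A x)"
  by (simp add: denom_def)

lemma moebius_of_real: "moebius A (of_real x) = of_real (moebius A x)"
  by (simp add: moebius_def denom_def)

lemma denom_mat_1 [simp]: "denom (mat 1) z = 1"
  by (simp add: denom_def)

lemma moebius_mat_1 [simp]: "moebius (mat 1) z = z"
  by (simp add: moebius_def)

lemma moebius_uminus [simp]: "moebius (- A) z = moebius A z"
proof -
  have "moebius (- A) z = - (of_real (A$1$1) * z + of_real (A$1$2)) / - denom A z"
    by (simp add: moebius_def denom_def)
  then show ?thesis by (simp add: moebius_def minus_divide_divide del: minus_add_distrib)
qed

lemma
  assumes "denom B z \<noteq> 0"
  shows denom_mult: "denom (A ** B) z = denom A (moebius B z) * denom B z"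
    and moebius_mult: "moebius (A ** B) z = moebius A (moebius B z)"
proof -
  have num: "moebius B z * denom B z = of_real (B$1$1) * z + of_real (B$1$2)"
    using assms by (simp add: moebius_def)
  show denom_mult: "denom (A ** B) z = denom A (moebius B z) * denom B z"
    unfolding denom_def[of A] distrib_right mult.assoc num
    by (simp add: denom_def mat2_mult_nth algebra_simps)
  have "of_real ((A ** B)$1$1) * z + of_real ((A ** B)$1$2)
      = (of_real (A$1$1) * moebius B z + of_real (A$1$2)) * denom B z"
    unfolding distrib_right mult.assoc num
    by (simp add: denom_def mat2_mult_nth algebra_simps)
  then show "moebius (A ** B) z = moebius A (moebius B z)"
    using assms by (simp add: moebius_def[of "A ** B"] moebius_def[of A] denom_mult)
qed

lemma
  assumes "A \<in> SL2" "denom A z \<noteq> 0"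
  shows denom_matrix_inv_moebius: "denom (matrix_inv A) (moebius A z) \<noteq> 0"
    and moebius_matrix_inv_moebius: "moebius (matrix_inv A) (moebius A z) = z"
proof -
  show "denom (matrix_inv A) (moebius A z) \<noteq> 0"
    using denom_mult[OF assms(2), of "matrix_inv A"] unfolding matrix_inv_left_SL2[OF assms(1)] by force
  show "moebius (matrix_inv A) (moebius A z) = z"
    using moebius_mult[OF assms(2), of "matrix_inv A"]
    unfolding matrix_inv_left_SL2[OF assms(1)] by simp
qed

lemma of_real_det_SL2:
  assumes "A \<in> SL2"
  shows "of_real (A$1$1) * of_real (A$2$2) - of_real (A$1$2) * of_real (A$2$1)
    = (1 :: 'a::real_algebra_1)"
  using assms by (simp add: mem_SL2_iff flip: of_real_mult of_real_diff)

lemma moebius_diff: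
  assumes "A \<in> SL2" "denom A z \<noteq> 0" "denom A w \<noteq> 0"
  shows "moebius A z - moebius A w = (z - w) / (denom A z * denom A w)"
proof -
  have "(of_real (A$1$1) * z + of_real (A$1$2)) * denom A w
      - (of_real (A$1$1) * w + of_real (A$1$2)) * denom A z
     = (of_real (A$1$1) * of_real (A$2$2) - of_real (A$1$2) * of_real (A$2$1)) * (z - w)"
    unfolding denom_def by (simp add: algebra_simps)
  also have "\<dots> = z - w"
    by (simp add: of_real_det_SL2[OF assms(1)])
  finally show ?thesis
    using assms(2,3) by (simp add: moebius_def diff_frac_eq)
qed

lemma lipschitz_on_moebius:
  assumes "A \<in> SL2" "0 < \<delta>"
  shows "(1 / \<delta>\<^sup>2)-lipschitz_on {z :: 'a::real_normed_field. \<delta> \<le> norm (denom A z)} (moebius A)"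
proof (rule lipschitz_onI)
  fix z w :: 'a
  assume "z \<in> {z. \<delta> \<le> norm (denom A z)}" "w \<in> {z. \<delta> \<le> norm (denom A z)}"
  then have z: "\<delta> \<le> norm (denom A z)" and w: "\<delta> \<le> norm (denom A w)"
    by simp_all
  with \<open>0 < \<delta>\<close> have "dist (moebius A z) (moebius A w)
      = norm (z - w) / (norm (denom A z) * norm (denom A w))"
    by (subst dist_norm, subst moebius_diff[OF assms(1)]) (auto simp: norm_divide norm_mult)
  also have "\<dots> \<le> norm (z - w) / (\<delta> * \<delta>)"
    using z w \<open>0 < \<delta>\<close> by (intro divide_left_mono mult_mono mult_pos_pos) auto
  finally show "dist (moebius A z) (moebius A w) \<le> 1 / \<delta>\<^sup>2 * dist z w"
    by (simp add: dist_norm power2_eq_square)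
qed simp

lemma hausdorff_content_moebius_image_eq_0:
  fixes X :: "'a::real_normed_field set"
  assumes "A \<in> SL2" "0 \<le> s" "hausdorff_content s X = 0"
  shows "hausdorff_content s (moebius A ` (X \<inter> {z. denom A z \<noteq> 0})) = 0"
proof -
  define Y where "Y n = X \<inter> {z. 1 / real (Suc n) \<le> norm (denom A z)}" for n
  have lipschitz: "(1 / (1 / real (Suc n))\<^sup>2)-lipschitz_on (Y n) (moebius A)" for n
    using lipschitz_on_moebius[OF assms(1), of "1 / real (Suc n)"]
    by (rule lipschitz_on_subset) (auto simp: Y_def)
  have null: "hausdorff_content s (Y n) = 0" for n
    using assms(3) by (rule hausdorff_content_eq_0_subset) (simp add: Y_def)
  have "hausdorff_content s (moebius A ` Y n) = 0" for n
    by (rule hausdorff_content_lipschitz_image_eq_0[OF lipschitz _ \<open>0 \<le> s\<close> null]) simp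
  then have "hausdorff_content s (\<Union>n. moebius A ` Y n) = 0"
    by (intro hausdorff_content_UN_eq_0) auto
  then show ?thesis
  proof (rule hausdorff_content_eq_0_subset)
    have "\<exists>n. z \<in> Y n" if z: "z \<in> X" "denom A z \<noteq> 0" for z
    proof -
      obtain n where "inverse (real (Suc n)) < norm (denom A z)"
        using reals_Archimedean[of "norm (denom A z)"] z(2) by auto
      then show ?thesis
        using z(1) by (intro exI[of _ n]) (simp add: Y_def inverse_eq_divide)
    qed
    then show "moebius A ` (X \<inter> {z. denom A z \<noteq> 0}) \<subseteq> (\<Union>n. moebius A ` Y n)"
      by blast
  qed
qed

definition translates :: "mat2 set \<Rightarrow> 'a::real_field set \<Rightarrow> 'a set" where
  "translates G X = (\<Union>A\<in>G. moebius A ` (X \<inter> {z. denom A z \<noteq> 0}))"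

lemma hausdorff_content_translates_eq_0:
  fixes X :: "'a::real_normed_field set"
  assumes "G \<subseteq> SL2" "countable G" "0 \<le> s" "hausdorff_content s X = 0"
  shows "hausdorff_content s (translates G X) = 0"
  unfolding translates_def using assms
  by (intro hausdorff_content_UN_eq_0 hausdorff_content_moebius_image_eq_0) auto

lemma subset_translates: "mat 1 \<in> G \<Longrightarrow> X \<subseteq> translates G X"
  unfolding translates_def by force

lemma moebius_mem_translates:
  assumes "sl2_subgroup G" "A \<in> G" "denom A z \<noteq> 0" "z \<in> translates G X"
  shows "moebius A z \<in> translates G X"
proof -
  obtain B x where "B \<in> G" "x \<in> X" "denom B x \<noteq> 0" and z: "z = moebius B x"
    using assms(4) by (auto simp: translates_def)
  then have "moebius A z = moebius (A ** B) x" "denom (A ** B) x \<noteq> 0"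
    using assms(3) by (simp_all add: moebius_mult denom_mult)
  moreover have "A ** B \<in> G"
    using assms(1,2) \<open>B \<in> G\<close> by (simp add: sl2_subgroup_def)
  ultimately show ?thesis
    using \<open>x \<in> X\<close> by (auto simp: translates_def)
qed

text \<open>This is \<open>A \<infinity>\<close>, except that division by zero gives \<open>0\<close> when \<open>A\<close> fixes \<open>\<infinity>\<close>.\<close>
definition centre :: "mat2 \<Rightarrow> real" where
  "centre A = A$1$1 / A$2$1"

definition disc :: "mat2 \<Rightarrow> 'a::real_normed_field set" where
  "disc A = cball (of_real (centre A)) (1 / (A$2$1)\<^sup>2)"

definition exterior :: "mat2 \<Rightarrow> 'a::real_normed_field set" where
  "exterior A = {z. 1 \<le> norm (z - of_real (centre (matrix_inv A)))}"

lemma mem_exterior_iff: "z \<in> exterior A \<longleftrightarrow> 1 \<le> norm (z - of_real (centre (matrix_inv A)))"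
  by (simp add: exterior_def)

lemma mem_disc_iff: "z \<in> disc A \<longleftrightarrow> norm (z - of_real (centre A)) \<le> 1 / (A$2$1)\<^sup>2"
  by (simp add: disc_def dist_norm norm_minus_commute)

lemma of_real_mem_disc_iff: "of_real x \<in> (disc A :: 'a::real_normed_field set) \<longleftrightarrow> x \<in> disc A"
  by (simp add: mem_disc_iff flip: of_real_diff)

lemma denom_eq_diff_centre:
  assumes "A \<in> SL2" "A$2$1 \<noteq> 0"
  shows "denom A z = of_real (A$2$1) * (z - of_real (centre (matrix_inv A)))"
  using assms(2) by (simp add: denom_def centre_def matrix_inv_SL2[OF assms(1)] algebra_simps)

lemma norm_denom:
  fixes z :: "'a::real_normed_field"
  assumes "A \<in> SL2" "A$2$1 \<noteq> 0"
  shows "norm (denom A z) = \<bar>A$2$1\<bar> * norm (z - of_real (centre (matrix_inv A)))"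
  by (simp add: denom_eq_diff_centre[OF assms] norm_mult)

lemma moebius_diff_centre:
  assumes "A \<in> SL2" "A$2$1 \<noteq> 0" "denom A z \<noteq> 0"
  shows "moebius A z - of_real (centre A) = - 1 / (of_real (A$2$1) * denom A z)"
proof -
  have "moebius A z - of_real (centre A)
      = ((of_real (A$1$1) * z + of_real (A$1$2)) * of_real (A$2$1) - of_real (A$1$1) * denom A z)
        / (of_real (A$2$1) * denom A z)"
    using assms(2,3) by (simp add: moebius_def centre_def diff_frac_eq mult.commute)
  also have "(of_real (A$1$1) * z + of_real (A$1$2)) * of_real (A$2$1) - of_real (A$1$1) * denom A z
      = - (of_real (A$1$1) * of_real (A$2$2) - of_real (A$1$2) * of_real (A$2$1))"
    by (simp add: denom_def algebra_simps)
  finally show ?thesis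
    by (simp only: of_real_det_SL2[OF assms(1)])
qed

lemma norm_moebius_diff_centre:
  fixes z :: "'a::real_normed_field"
  assumes "A \<in> SL2" "A$2$1 \<noteq> 0" "z \<noteq> of_real (centre (matrix_inv A))"
  shows "norm (moebius A z - of_real (centre A))
    = 1 / ((A$2$1)\<^sup>2 * norm (z - of_real (centre (matrix_inv A))))"
proof -
  have "denom A z \<noteq> 0"
    using assms by (simp add: denom_eq_diff_centre)
  then show ?thesis
    by (simp add: moebius_diff_centre[OF assms(1,2)] norm_divide norm_mult norm_denom[OF assms(1,2)]
        power2_eq_square flip: abs_mult)
qed

lemma moebius_mem_disc:
  fixes z :: "'a::real_normed_field"
  assumes "A \<in> SL2" "A$2$1 \<noteq> 0" "z \<in> exterior A"
  shows "moebius A z \<in> disc A"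
proof -
  have "z \<noteq> of_real (centre (matrix_inv A))"
    using assms(3) by (auto simp: mem_exterior_iff)
  moreover have "1 / ((A$2$1)\<^sup>2 * norm (z - of_real (centre (matrix_inv A)))) \<le> 1 / ((A$2$1)\<^sup>2 * 1)"
    using assms(2,3)
    by (intro divide_left_mono mult_left_mono mult_pos_pos) (auto simp: mem_exterior_iff)
  ultimately show ?thesis
    by (simp add: mem_disc_iff norm_moebius_diff_centre[OF assms(1,2)])
qed

lemma lipschitz_on_moebius_exterior:
  assumes "A \<in> SL2" "A$2$1 \<noteq> 0"
  shows "(1 / (A$2$1)\<^sup>2)-lipschitz_on (exterior A :: 'a::real_normed_field set) (moebius A)"
proof -
  have "(exterior A :: 'a set) \<subseteq> {z. \<bar>A$2$1\<bar> \<le> norm (denom A z)}"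
    using assms(2) by (auto simp: mem_exterior_iff norm_denom[OF assms])
  then show ?thesis
    using lipschitz_on_moebius[OF assms(1), of "\<bar>A$2$1\<bar>"] assms(2) by (auto intro: lipschitz_on_subset)
qed

lemma hausdorff_content_disc_le:
  "hausdorff_content s (disc A :: real set) \<le> ennreal (2 powr s) * ennreal ((1 / (A$2$1)\<^sup>2) powr s)"
proof -
  have "hausdorff_content s (disc A :: real set) \<le> ennreal (diameter (disc A :: real set) powr s)"
    by (rule hausdorff_content_le_diameter) (simp add: disc_def)
  also have "\<dots> = ennreal ((2 * (1 / (A$2$1)\<^sup>2)) powr s)"
    by (simp add: disc_def)
  also have "\<dots> = ennreal (2 powr s) * ennreal ((1 / (A$2$1)\<^sup>2) powr s)"
    by (simp only: powr_mult ennreal_mult powr_ge_zero)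
  finally show ?thesis .
qed

lemma moebius_matrix_inv_mem_exterior:
  fixes z :: "'a::real_normed_field"
  assumes "A \<in> SL2" "A$2$1 \<noteq> 0" "z \<in> disc A" "z \<noteq> of_real (centre A)"
  shows "moebius (matrix_inv A) z \<in> exterior A"
proof -
  have "0 < (A$2$1)\<^sup>2 * norm (z - of_real (centre A))"
    using assms(2,4) by simp
  moreover have "(A$2$1)\<^sup>2 * norm (z - of_real (centre A)) \<le> 1"
    using assms(2,3) by (simp add: mem_disc_iff field_simps)
  moreover have "(matrix_inv A)$2$1 = - A$2$1"
    by (simp add: matrix_inv_SL2[OF assms(1)])
  ultimately show ?thesis
    using norm_moebius_diff_centre[OF SL2_matrix_inv[OF assms(1)], of z] assms(2,4)
    by (simp add: mem_exterior_iff matrix_inv_matrix_inv_SL2[OF assms(1)])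
qed

section \<open>The hyperbolic plane\<close>

lemma denom_uhp: "A \<in> SL2 \<Longrightarrow> z \<in> uhp \<Longrightarrow> denom A z \<noteq> 0"
  by (auto simp: denom_def uhp_def complex_eq_iff mem_SL2_iff)

lemma Im_moebius:
  assumes "A \<in> SL2"
  shows "Im (moebius A z) = Im z / (cmod (denom A z))\<^sup>2"
proof -
  have "moebius A z
      = (of_real (A$1$1) * z + of_real (A$1$2)) * cnj (denom A z) / of_real ((cmod (denom A z))\<^sup>2)"
    unfolding moebius_def by (rule complex_div_cnj)
  then have "Im (moebius A z) = (A$1$1 * A$2$2 - A$1$2 * A$2$1) * Im z / (cmod (denom A z))\<^sup>2"
    by (simp only: Im_divide_of_real) (simp add: denom_def algebra_simps)
  then show ?thesis
    using assms by (simp add: mem_SL2_iff)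
qed

lemma moebius_uhp: "A \<in> SL2 \<Longrightarrow> z \<in> uhp \<Longrightarrow> moebius A z \<in> uhp"
  using denom_uhp[of A z] by (simp add: uhp_def Im_moebius)

lemma hdist_moebius:
  assumes A: "A \<in> SL2" and z: "z \<in> uhp" and w: "w \<in> uhp"
  shows "hdist (moebius A z) (moebius A w) = hdist z w"
proof -
  have nz: "cmod (denom A z) \<noteq> 0" "cmod (denom A w) \<noteq> 0"
    using denom_uhp[OF A] z w by auto
  have "(cmod (moebius A z - moebius A w))\<^sup>2 / (2 * Im (moebius A z) * Im (moebius A w))
      = (cmod (z - w))\<^sup>2 / (2 * Im z * Im w)"
    unfolding Im_moebius[OF A] moebius_diff[OF A denom_uhp[OF A z] denom_uhp[OF A w]]
    using nz by (simp add: norm_divide norm_mult power_divide power_mult_distrib)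
  then show ?thesis unfolding hdist_def by simp
qed

lemma hdist_commute: "hdist z w = hdist w z"
  by (simp add: hdist_def norm_minus_commute mult.commute mult.left_commute)

lemma hdist_nonneg: "z \<in> uhp \<Longrightarrow> w \<in> uhp \<Longrightarrow> 0 \<le> hdist z w"
  unfolding hdist_def uhp_def by (intro arcosh_nonneg_real) auto

lemma cosh_hdist:
  assumes "z \<in> uhp" "w \<in> uhp"
  shows "cosh (hdist z w) = ((Re z - Re w)\<^sup>2 + (Im z)\<^sup>2 + (Im w)\<^sup>2) / (2 * Im z * Im w)"
proof -
  have pos: "0 < Im z" "0 < Im w" using assms by (simp_all add: uhp_def)
  then have "cosh (hdist z w) = 1 + (cmod (z - w))\<^sup>2 / (2 * Im z * Im w)"
    unfolding hdist_def by (intro cosh_arcosh_real) simp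
  also have "\<dots> = ((Re z - Re w)\<^sup>2 + (Im z)\<^sup>2 + (Im w)\<^sup>2) / (2 * Im z * Im w)"
    unfolding cmod_power2 using pos by (simp add: field_simps power2_eq_square)
  finally show ?thesis .
qed

lemma cosh_hdist_triangle:
  assumes "x \<in> uhp" "y \<in> uhp" "z \<in> uhp"
  shows "cosh (hdist x z) \<le> 2 * cosh (hdist x y) * cosh (hdist y z)"
proof -
  define u v where "u = Re x - Re y" and "v = Re y - Re z"
  define a q b where "a = Im x" and "q = Im y" and "b = Im z"
  have pos: "0 < a" "0 < q" "0 < b" using assms by (simp_all add: uhp_def a_def q_def b_def)
  have "(u\<^sup>2 + a\<^sup>2 + q\<^sup>2) * (v\<^sup>2 + q\<^sup>2 + b\<^sup>2) - q\<^sup>2 * ((u + v)\<^sup>2 + a\<^sup>2 + b\<^sup>2)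
      = (u * v - q\<^sup>2)\<^sup>2 + (u * b)\<^sup>2 + (a * v)\<^sup>2 + (a * b)\<^sup>2"
    by algebra
  also have "\<dots> \<ge> 0" by simp
  finally have "q\<^sup>2 * ((u + v)\<^sup>2 + a\<^sup>2 + b\<^sup>2) / (2 * a * b * q\<^sup>2)
      \<le> (u\<^sup>2 + a\<^sup>2 + q\<^sup>2) * (v\<^sup>2 + q\<^sup>2 + b\<^sup>2) / (2 * a * b * q\<^sup>2)"
    using pos by (intro divide_right_mono) auto
  moreover have "q\<^sup>2 * N / (2 * a * b * q\<^sup>2) = N / (2 * a * b)" for N
    using pos by simp
  moreover have "M * N / (2 * a * b * q\<^sup>2) = 2 * (M / (2 * a * q)) * (N / (2 * q * b))" for M N
    by (simp add: power2_eq_square)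
  ultimately have "((u + v)\<^sup>2 + a\<^sup>2 + b\<^sup>2) / (2 * a * b)
      \<le> 2 * ((u\<^sup>2 + a\<^sup>2 + q\<^sup>2) / (2 * a * q)) * ((v\<^sup>2 + q\<^sup>2 + b\<^sup>2) / (2 * q * b))"
    by (simp only:)
  then show ?thesis
    by (simp add: cosh_hdist assms u_def v_def a_def q_def b_def)
qed

lemma norm_denom_le:
  assumes "w \<in> uhp"
  shows "cmod (denom A z) \<le> (1 + cmod (z - w) / Im w) * cmod (denom A w)"
proof -
  have "0 < Im w" using assms by (simp add: uhp_def)
  have "\<bar>A$2$1\<bar> * Im w \<le> cmod (denom A w)"
    using abs_Im_le_cmod[of "denom A w"] \<open>0 < Im w\<close> by (simp add: denom_def abs_mult)
  then have lower_left_le: "\<bar>A$2$1\<bar> \<le> cmod (denom A w) / Im w"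
    using \<open>0 < Im w\<close> by (simp add: field_simps)
  have "denom A z = denom A w + of_real (A$2$1) * (z - w)"
    by (simp add: denom_def algebra_simps)
  then have "cmod (denom A z) \<le> cmod (denom A w) + \<bar>A$2$1\<bar> * cmod (z - w)"
    using norm_triangle_ineq[of "denom A w" "of_real (A$2$1) * (z - w)"] by (simp add: norm_mult)
  also have "\<dots> \<le> cmod (denom A w) + cmod (denom A w) / Im w * cmod (z - w)"
    using lower_left_le by (intro add_left_mono mult_right_mono) auto
  finally show ?thesis by (simp add: algebra_simps)
qed

lemma cmod_moebius_diff_le:
  assumes A: "A \<in> SL2" and z: "z \<in> uhp" and w: "w \<in> uhp"
  shows "cmod (moebius A z - moebius A w)
    \<le> (cmod (z - w) * (1 + cmod (z - w) / Im w) / Im z) * Im (moebius A z)"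
proof -
  let ?dz = "cmod (denom A z)" and ?dw = "cmod (denom A w)" and ?K = "1 + cmod (z - w) / Im w"
  have pos: "0 < ?dz" "0 < ?dw" "0 < Im z" "0 < Im w"
    using denom_uhp[OF A] z w by (auto simp: uhp_def)
  have "?dz * ?dz \<le> ?K * ?dw * ?dz"
    using norm_denom_le[OF w] pos by (intro mult_right_mono) auto
  then have "1 / (?dz * ?dw) \<le> ?K / (?dz * ?dz)"
    using pos by (simp add: divide_simps mult_ac)
  then have "cmod (z - w) * (1 / (?dz * ?dw)) \<le> cmod (z - w) * (?K / (?dz * ?dz))"
    by (rule mult_left_mono) simp
  then show ?thesis
    using pos unfolding moebius_diff[OF A denom_uhp[OF A z] denom_uhp[OF A w]] Im_moebius[OF A]
    by (simp add: norm_divide norm_mult power2_eq_square mult_ac)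
qed

lemma orbit_eq: "orbit G z = (\<lambda>A. moebius A z) ` G"
  by (simp add: orbit_def act_eq_moebius)

text \<open>Both orbits are asymptotic near the boundary, as \<open>d(A z, A w)\<close> does not depend on \<open>A\<close>.\<close>
lemma limit_set_change_basepoint:
  assumes G: "G \<subseteq> SL2" and z: "z \<in> uhp" and w: "w \<in> uhp" and x: "Some x \<in> limit_set G z"
  shows "Some x \<in> limit_set G w"
proof -
  obtain p where p: "\<And>n. p n \<in> orbit G z" and p_lim: "p \<longlonglongrightarrow> complex_of_real x"
    using x by (auto simp: limit_set_def conv_bdry_def)
  have "\<forall>n. \<exists>A\<in>G. p n = moebius A z"
    using p unfolding orbit_eq by blast
  then obtain A where A: "\<And>n. A n \<in> G" and p_eq: "\<And>n. p n = moebius (A n) z"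
    by metis
  define K where "K = cmod (z - w) * (1 + cmod (z - w) / Im w) / Im z"
  have close: "cmod (p n - moebius (A n) w) \<le> K * Im (p n)" for n
    using cmod_moebius_diff_le[OF _ z w] A G unfolding p_eq K_def by blast
  have "(\<lambda>n. K * Im (p n)) \<longlonglongrightarrow> K * Im (complex_of_real x)"
    using p_lim by (intro tendsto_intros)
  then have "(\<lambda>n. p n - moebius (A n) w) \<longlonglongrightarrow> 0"
    by (intro Lim_null_comparison[OF always_eventually[OF allI[OF close]]]) simp
  from tendsto_diff[OF p_lim this] have "(\<lambda>n. moebius (A n) w) \<longlonglongrightarrow> complex_of_real x"
    by simp
  then show ?thesis
    using A unfolding limit_set_def conv_bdry_def orbit_eq
    by (intro CollectI exI[of _ "\<lambda>n. moebius (A n) w"]) auto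
qed

lemma limit_set_moebius:
  assumes G: "sl2_subgroup G" and "A \<in> G" and z: "z \<in> uhp"
    and x: "Some x \<in> limit_set G z" and "denom A x \<noteq> 0"
  shows "Some (moebius A x) \<in> limit_set G z"
proof -
  obtain p where p: "\<And>n. p n \<in> orbit G z" and p_lim: "p \<longlonglongrightarrow> complex_of_real x"
    using x by (auto simp: limit_set_def conv_bdry_def)
  have "denom A (complex_of_real x) \<noteq> 0"
    using \<open>denom A x \<noteq> 0\<close> by (simp add: denom_of_real)
  then have "(\<lambda>n. moebius A (p n)) \<longlonglongrightarrow> moebius A (complex_of_real x)"
    unfolding moebius_def denom_def using p_lim by (intro tendsto_intros)
  moreover have "moebius A (p n) \<in> orbit G z" for n
  proof -
    obtain B where "B \<in> G" "p n = moebius B z"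
      using p by (auto simp: orbit_eq)
    moreover from this have "denom B z \<noteq> 0"
      using G denom_uhp[OF _ z] by (auto simp: sl2_subgroup_def)
    ultimately have "moebius A (p n) = moebius (A ** B) z" "A ** B \<in> G"
      using G \<open>A \<in> G\<close> by (simp_all add: moebius_mult sl2_subgroup_def)
    then show ?thesis by (simp add: orbit_eq)
  qed
  ultimately show ?thesis
    unfolding limit_set_def conv_bdry_def moebius_of_real
    by (intro CollectI exI[of _ "\<lambda>n. moebius A (p n)"]) simp
qed

section \<open>Geodesic rays\<close>

definition scale_Im :: "real \<Rightarrow> complex \<Rightarrow> complex" where
  "scale_Im r z = Complex (Re z) (r * Im z)"

text \<open>In the coordinate \<open>1 / (x - z)\<close> the geodesics ending at \<open>x\<close> are the vertical lines.\<close>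
definition ray :: "complex \<Rightarrow> real \<Rightarrow> real \<Rightarrow> complex" where
  "ray z x t = of_real x - 1 / scale_Im (exp t) (1 / (of_real x - z))"

lemma scale_Im_uhp: "0 < r \<Longrightarrow> z \<in> uhp \<Longrightarrow> scale_Im r z \<in> uhp"
  by (simp add: scale_Im_def uhp_def)

lemma scale_Im_affine:
  "scale_Im r (of_real a * z + of_real b) = of_real a * scale_Im r z + of_real b"
  by (simp add: scale_Im_def complex_eq_iff)

lemma hdist_scale_Im:
  assumes "z \<in> uhp"
  shows "hdist (scale_Im (exp s) z) (scale_Im (exp t) z) = \<bar>s - t\<bar>"
proof -
  have in_uhp: "scale_Im (exp s) z \<in> uhp" "scale_Im (exp t) z \<in> uhp"
    using assms by (simp_all add: scale_Im_uhp)
  then have "cosh (hdist (scale_Im (exp s) z) (scale_Im (exp t) z)) = cosh (s - t)"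
    using assms unfolding cosh_hdist[OF in_uhp]
    by (simp add: scale_Im_def uhp_def cosh_def exp_diff exp_minus field_simps power2_eq_square)
  also have "\<dots> = cosh \<bar>s - t\<bar>"
    by (simp add: abs_if cosh_minus[of "s - t", symmetric])
  finally show ?thesis
    using hdist_nonneg[OF in_uhp] by simp
qed

lemma cosh_hdist_scale_Im_le:
  assumes "1 \<le> r" and z: "z \<in> uhp" and w: "w \<in> uhp"
  shows "cosh (hdist (scale_Im r z) (scale_Im r w)) \<le> cosh (hdist z w)"
proof -
  have pos: "0 < r" "0 < Im z" "0 < Im w" using assms by (simp_all add: uhp_def)
  have "(Re z - Re w)\<^sup>2 \<le> r\<^sup>2 * (Re z - Re w)\<^sup>2"
    using mult_right_mono[of 1 "r\<^sup>2" "(Re z - Re w)\<^sup>2"] \<open>1 \<le> r\<close> by (simp add: one_le_power)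
  then have "((Re z - Re w)\<^sup>2 + (r * Im z)\<^sup>2 + (r * Im w)\<^sup>2) / (2 * (r * Im z) * (r * Im w))
      \<le> r\<^sup>2 * ((Re z - Re w)\<^sup>2 + (Im z)\<^sup>2 + (Im w)\<^sup>2) / (2 * (r * Im z) * (r * Im w))"
    using pos by (intro divide_right_mono) (simp_all add: algebra_simps power_mult_distrib)
  also have "\<dots> = ((Re z - Re w)\<^sup>2 + (Im z)\<^sup>2 + (Im w)\<^sup>2) / (2 * Im z * Im w)"
    using pos by (simp add: power2_eq_square)
  finally show ?thesis
    using pos(1) z w by (simp add: cosh_hdist scale_Im_uhp) (simp add: scale_Im_def)
qed

lemma inverse_diff_uhp:
  assumes "z \<in> uhp"
  shows "1 / (of_real x - z) \<in> uhp"
proof -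
  have "of_real x - z \<noteq> 0" using assms by (auto simp: uhp_def complex_eq_iff)
  then have "0 < (x - Re z)\<^sup>2 + (Im z)\<^sup>2" by (simp add: sum_power2_gt_zero_iff complex_eq_iff)
  then show ?thesis
    using assms by (simp add: uhp_def Im_divide)
qed

lemma
  assumes "u \<in> uhp" "v \<in> uhp"
  shows diff_inverse_uhp: "of_real x - 1 / u \<in> uhp"
    and hdist_diff_inverse: "hdist (of_real x - 1 / u) (of_real x - 1 / v) = hdist u v"
proof -
  have "mk2 x (-1) 1 0 \<in> SL2" by (simp add: mem_SL2_iff)
  moreover have "of_real x - 1 / u' = moebius (mk2 x (-1) 1 0) u'" if "u' \<in> uhp" for u'
    using that by (auto simp: moebius_def denom_def diff_divide_distrib uhp_def)
  ultimately show "of_real x - 1 / u \<in> uhp" "hdist (of_real x - 1 / u) (of_real x - 1 / v) = hdist u v"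
    using assms by (simp_all add: moebius_uhp hdist_moebius)
qed

lemma ray_uhp: "z \<in> uhp \<Longrightarrow> ray z x t \<in> uhp"
  by (simp add: ray_def diff_inverse_uhp scale_Im_uhp inverse_diff_uhp)

lemma geodesic_ray_ray:
  assumes "z \<in> uhp"
  shows "geodesic_ray z (ray z x)"
proof -
  have "ray z x 0 = z" by (simp add: ray_def scale_Im_def)
  moreover have "hdist (ray z x s) (ray z x t) = \<bar>s - t\<bar>" for s t
    using assms by (simp add: ray_def hdist_diff_inverse scale_Im_uhp inverse_diff_uhp hdist_scale_Im)
  ultimately show ?thesis
    using assms by (simp add: geodesic_ray_def ray_uhp)
qed

lemma conv_bdry_ray:
  assumes "z \<in> uhp"
  shows "conv_bdry at_top (ray z x) (Some x)"
proof -
  define u where "u = 1 / (of_real x - z)"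
  have "0 < Im u" using inverse_diff_uhp[OF assms] by (simp add: u_def uhp_def)
  have bound: "cmod (1 / scale_Im (exp t) u) \<le> exp (- t) / Im u" for t
  proof -
    have "exp t * Im u \<le> cmod (scale_Im (exp t) u)"
      using abs_Im_le_cmod[of "scale_Im (exp t) u"] by (simp add: scale_Im_def)
    then have "1 / cmod (scale_Im (exp t) u) \<le> 1 / (exp t * Im u)"
      using \<open>0 < Im u\<close> by (intro frac_le) auto
    then show ?thesis by (simp add: norm_divide exp_minus field_simps)
  qed
  have "((\<lambda>t. exp (- t) / Im u) \<longlongrightarrow> 0) at_top"
    by (intro tendsto_divide_zero filterlim_compose[OF exp_at_bot filterlim_uminus_at_bot_at_top])
  then have "((\<lambda>t. 1 / scale_Im (exp t) u) \<longlongrightarrow> 0) at_top"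
    by (rule Lim_null_comparison[OF always_eventually[OF allI[OF bound]]])
  then have "((\<lambda>t. of_real x - 1 / scale_Im (exp t) u) \<longlongrightarrow> of_real x - 0) at_top"
    by (intro tendsto_diff tendsto_const)
  then show ?thesis by (simp add: conv_bdry_def ray_def[abs_def] u_def)
qed

lemma cosh_hdist_ray_le:
  assumes "z \<in> uhp" "w \<in> uhp" "0 \<le> t"
  shows "cosh (hdist (ray z x t) (ray w x t)) \<le> cosh (hdist z w)"
proof -
  let ?u = "\<lambda>z. 1 / (of_real x - z)"
  have "cosh (hdist (ray z x t) (ray w x t)) \<le> cosh (hdist (?u z) (?u w))"
    using assms
    by (simp add: ray_def hdist_diff_inverse scale_Im_uhp inverse_diff_uhp cosh_hdist_scale_Im_le)
  also have "hdist (?u z) (?u w) = hdist z w"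
    using hdist_diff_inverse[of "?u z" "?u w" x] assms by (simp add: inverse_diff_uhp)
  finally show ?thesis .
qed

lemma moebius_ray:
  assumes A: "A \<in> SL2" and x: "denom A x \<noteq> 0" and z: "z \<in> uhp"
  shows "moebius A (ray z x t) = ray (moebius A z) (moebius A x) t"
proof -
  define d where "d = denom A x"
  have coordinate: "1 / (of_real (moebius A x) - moebius A w)
      = of_real (d\<^sup>2) * (1 / (of_real x - w)) + of_real (- A$2$1 * d)" if w: "w \<in> uhp" for w
  proof -
    define e where "e = of_real x - w"
    have "e \<noteq> 0" using w by (auto simp: e_def uhp_def complex_eq_iff)
    have "of_real (moebius A x) - moebius A w = e / (of_real d * denom A w)"
      using moebius_diff[OF A _ denom_uhp[OF A w], of "of_real x"] x
      by (simp add: moebius_of_real denom_of_real d_def e_def)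
    then have "1 / (of_real (moebius A x) - moebius A w) = of_real d * denom A w / e"
      by simp
    also have "denom A w = of_real d - of_real (A$2$1) * e"
      by (simp add: denom_def d_def e_def algebra_simps)
    also have "of_real d * (of_real d - of_real (A$2$1) * e) / e
        = of_real (d\<^sup>2) * (1 / e) + of_real (- A$2$1 * d)"
      using \<open>e \<noteq> 0\<close> by (simp add: field_simps power2_eq_square)
    finally show ?thesis by (simp only: e_def)
  qed
  have "1 / (of_real x - ray z x t) = scale_Im (exp t) (1 / (of_real x - z))"
    by (simp add: ray_def)
  then have "1 / (of_real (moebius A x) - moebius A (ray z x t))
      = scale_Im (exp t) (1 / (of_real (moebius A x) - moebius A z))"
    by (simp only: coordinate z ray_uhp scale_Im_affine)
  then have "of_real (moebius A x) - moebius A (ray z x t)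
      = 1 / scale_Im (exp t) (1 / (of_real (moebius A x) - moebius A z))"
    by (metis div_by_1 divide_divide_eq_right mult_1)
  then show ?thesis by (simp add: ray_def algebra_simps)
qed

lemma ray_at_unit_height:
  assumes z: "z \<in> uhp" "Im z \<le> 1" and separated: "1/2 \<le> \<bar>x - Re z\<bar>"
  defines "w \<equiv> ray z x (- ln (Im z))"
  shows "1/5 \<le> Im w" "Im w \<le> 1" "\<bar>Re w - Re z\<bar> \<le> 1/2"
proof -
  define d h n where "d = x - Re z" and "h = Im z" and "n = d\<^sup>2 + h\<^sup>2"
  have h: "0 < h" "h\<^sup>2 \<le> 1" using z by (simp_all add: uhp_def h_def power_le_one)
  have d: "1/4 \<le> d\<^sup>2" using power_mono[OF separated, of 2] by (simp add: d_def power2_eq_square)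
  have "0 < n" using h(1) by (simp add: n_def add_nonneg_pos)
  have "0 < d\<^sup>2 + 1" by (simp add: add_nonneg_pos)
  have "1 / (of_real x - z) = Complex (d / n) (h / n)"
    by (simp add: complex_eq_iff Re_divide Im_divide d_def h_def n_def power2_eq_square)
  then have "scale_Im (exp (- ln h)) (1 / (of_real x - z)) = Complex (d / n) (1 / n)"
    using h(1) by (simp add: scale_Im_def exp_minus)
  moreover have "1 / Complex (d / n) (1 / n) = Complex (d * n / (d\<^sup>2 + 1)) (- n / (d\<^sup>2 + 1))"
    using \<open>0 < n\<close> by (simp add: complex_eq_iff Re_divide Im_divide power2_eq_square field_simps)
  ultimately have w: "w = of_real x - Complex (d * n / (d\<^sup>2 + 1)) (- n / (d\<^sup>2 + 1))"
    by (simp add: w_def ray_def h_def)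
  have Im_w: "Im w = n / (d\<^sup>2 + 1)" by (simp add: w)
  show "1/5 \<le> Im w"
    unfolding Im_w le_divide_eq using d \<open>0 < d\<^sup>2 + 1\<close> by (simp add: n_def algebra_simps add_increasing2)
  show "Im w \<le> 1"
    unfolding Im_w using h(2) \<open>0 < d\<^sup>2 + 1\<close> by (simp add: n_def)
  have "Re w - Re z = d - d * n / (d\<^sup>2 + 1)" by (simp add: w d_def)
  also have "\<dots> = d * (1 - h\<^sup>2) / (d\<^sup>2 + 1)"
    using \<open>0 < d\<^sup>2 + 1\<close> by (simp add: n_def field_simps)
  finally have Re_diff: "\<bar>Re w - Re z\<bar> = \<bar>d\<bar> * (1 - h\<^sup>2) / (d\<^sup>2 + 1)"
    using \<open>0 < d\<^sup>2 + 1\<close> h(2) by (simp add: abs_mult)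
  have "\<bar>d\<bar> * (1 - h\<^sup>2) \<le> \<bar>d\<bar> * 1"
    by (intro mult_left_mono) auto
  moreover have "2 * \<bar>d\<bar> \<le> d\<^sup>2 + 1"
    using zero_le_power2[of "\<bar>d\<bar> - 1"] by (simp add: power2_diff)
  ultimately show "\<bar>Re w - Re z\<bar> \<le> 1/2"
    unfolding Re_diff using \<open>0 < d\<^sup>2 + 1\<close> by (simp add: divide_simps)
qed

lemma orbit_dist_le:
  assumes G: "sl2_subgroup G" and "A \<in> G" and z: "z \<in> uhp" and p: "p \<in> uhp"
  shows "orbit_dist G z p \<le> hdist (moebius A p) z"
proof -
  have SL2: "B \<in> G \<Longrightarrow> B \<in> SL2" for B
    using G by (auto simp: sl2_subgroup_def)
  have inv: "matrix_inv A \<in> G"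
    using G \<open>A \<in> G\<close> by (simp add: sl2_subgroup_def)
  have "moebius A (moebius (matrix_inv A) z) = z"
    using moebius_mult[OF denom_uhp[OF SL2[OF inv] z], of A] SL2[OF \<open>A \<in> G\<close>]
    by (simp add: matrix_inv_right_SL2)
  then have "hdist (moebius A p) z = hdist p (moebius (matrix_inv A) z)"
    using hdist_moebius[OF SL2[OF \<open>A \<in> G\<close>] p moebius_uhp[OF SL2[OF inv] z]] by simp
  moreover have "bdd_below (hdist p ` orbit G z)"
    using SL2 p z by (intro bdd_belowI2[of _ 0]) (auto simp: orbit_eq intro!: hdist_nonneg moebius_uhp)
  ultimately show ?thesis
    unfolding orbit_dist_def using inv by (auto simp: orbit_eq intro!: cInf_lower)
qed

lemma le_2_cosh: "x \<le> 2 * cosh x" for x :: real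
proof -
  have "x \<le> exp x" using exp_ge_add_one_self[of x] by linarith
  also have "\<dots> \<le> 2 * cosh x" by (simp add: cosh_def)
  finally show ?thesis .
qed

lemma orbit_dist_ray_le:
  assumes G: "sl2_subgroup G" and "A \<in> G" and z: "z \<in> uhp" and w: "w \<in> uhp" and "0 \<le> t"
  shows "orbit_dist G z (ray z x t) \<le> 8 * (cosh (hdist z w))\<^sup>2 * cosh (hdist (moebius A (ray w x t)) w)"
proof -
  define p q where "p = moebius A (ray z x t)" and "q = moebius A (ray w x t)"
  have "A \<in> SL2" using G \<open>A \<in> G\<close> by (auto simp: sl2_subgroup_def)
  have in_uhp: "p \<in> uhp" "q \<in> uhp"
    using \<open>A \<in> SL2\<close> z w by (simp_all add: p_def q_def moebius_uhp ray_uhp)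
  have "cosh (hdist p q) \<le> cosh (hdist z w)"
    using cosh_hdist_ray_le[OF z w \<open>0 \<le> t\<close>] \<open>A \<in> SL2\<close> z w
    by (simp add: p_def q_def hdist_moebius ray_uhp)
  moreover have "cosh (hdist q z) \<le> 2 * cosh (hdist q w) * cosh (hdist z w)"
    using cosh_hdist_triangle[OF in_uhp(2) w z] by (simp add: hdist_commute)
  ultimately have "2 * cosh (hdist p q) * cosh (hdist q z)
      \<le> 2 * cosh (hdist z w) * (2 * cosh (hdist q w) * cosh (hdist z w))"
    by (intro mult_mono) auto
  with cosh_hdist_triangle[OF in_uhp z]
  have "2 * cosh (hdist p z) \<le> 8 * (cosh (hdist z w))\<^sup>2 * cosh (hdist q w)"
    by (simp add: power2_eq_square algebra_simps)
  moreover have "orbit_dist G z (ray z x t) \<le> 2 * cosh (hdist p z)"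
    using orbit_dist_le[OF G \<open>A \<in> G\<close> z ray_uhp[OF z]] le_2_cosh unfolding p_def by (rule order_trans)
  ultimately show ?thesis
    by (simp add: q_def)
qed

text \<open>Rays with the same endpoint stay close, so the base point of the ray may be changed.\<close>
lemma transient_ray_escapes:
  assumes G: "sl2_subgroup G" and z: "z \<in> uhp" and w: "w \<in> uhp"
    and x: "Some x \<in> transient_limit_set G z"
  shows "\<forall>\<^sub>F t in at_top. \<forall>A\<in>G. C < cosh (hdist (moebius A (ray w x t)) w)"
proof -
  let ?D = "8 * (cosh (hdist z w))\<^sup>2"
  have "filterlim (\<lambda>t. orbit_dist G z (ray z x t)) at_top at_top"
    using x geodesic_ray_ray[OF z] conv_bdry_ray[OF z] by (simp add: transient_limit_set_def)
  then have "\<forall>\<^sub>F t in at_top. ?D * C < orbit_dist G z (ray z x t)"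
    by (simp add: filterlim_at_top_dense)
  then show ?thesis
    using eventually_ge_at_top[of 0]
  proof eventually_elim
    case (elim t)
    show ?case
    proof
      fix A assume "A \<in> G"
      have "?D * C < ?D * cosh (hdist (moebius A (ray w x t)) w)"
        using elim(1) orbit_dist_ray_le[OF G \<open>A \<in> G\<close> z w elim(2)] by (rule less_le_trans)
      then show "C < cosh (hdist (moebius A (ray w x t)) w)"
        by simp
    qed
  qed
qed

section \<open>Integral matrices and the level-2 congruence subgroup\<close>

lemma norm_diff_integral_matrix_ge_1:
  fixes A B :: "real^'n^'m"
  assumes "\<And>i j. A $ i $ j \<in> \<int>" "\<And>i j. B $ i $ j \<in> \<int>" "A \<noteq> B"
  shows "1 \<le> norm (A - B)"
proof -
  obtain i j where "A $ i $ j - B $ i $ j \<noteq> 0"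
    using \<open>A \<noteq> B\<close> by (auto simp: vec_eq_iff)
  moreover have "A $ i $ j - B $ i $ j \<in> \<int>"
    using assms(1,2) by simp
  ultimately have "1 \<le> \<bar>(A - B) $ i $ j\<bar>"
    using Ints_nonzero_abs_ge1 by fastforce
  also have "\<dots> \<le> norm ((A - B) $ i)"
    using Finite_Cartesian_Product.norm_nth_le[of "(A - B) $ i" j] by simp
  also have "\<dots> \<le> norm (A - B)"
    by (rule Finite_Cartesian_Product.norm_nth_le)
  finally show ?thesis .
qed

abbreviation mk2_int :: "int \<Rightarrow> int \<Rightarrow> int \<Rightarrow> int \<Rightarrow> mat2" where
  "mk2_int a b c d \<equiv> mk2 (of_int a) (of_int b) (of_int c) (of_int d)"

definition congruence_subgroup_2 :: "mat2 set" where
  "congruence_subgroup_2 =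
     {A \<in> SL2. \<exists>a b c d. A = mk2_int a b c d \<and> odd a \<and> even b \<and> even c \<and> odd d}"

lemma mk2_mem_congruence_subgroup_2:
  assumes "mk2_int a b c d \<in> SL2" "odd a" "even b" "even c" "odd d"
  shows "mk2_int a b c d \<in> congruence_subgroup_2"
  using assms unfolding congruence_subgroup_2_def by blast

lemma congruence_subgroup_2_cases:
  assumes "A \<in> congruence_subgroup_2"
  obtains a b c d where "A = mk2_int a b c d"
    "odd a" "even b" "even c" "odd d" "a * d - b * c = 1"
proof -
  obtain a b c d where A: "A = mk2_int a b c d"
    and parity: "odd a" "even b" "even c" "odd d" and "A \<in> SL2"
    using assms unfolding congruence_subgroup_2_def by blast
  then have "real_of_int (a * d - b * c) = of_int 1"
    by (simp add: mem_SL2_iff)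
  then have "a * d - b * c = 1"
    by (simp only: of_int_eq_iff)
  with A parity show thesis by (rule that)
qed

lemma congruence_subgroup_2_mat_1: "mat 1 \<in> congruence_subgroup_2"
proof -
  have "mk2 1 0 0 1 = mat 1" by (simp add: mat2_eq_iff)
  then show ?thesis
    using mk2_mem_congruence_subgroup_2[of 1 0 0 1] by (simp add: SL2_mat_1)
qed

lemma congruence_subgroup_2_uminus:
  assumes "A \<in> congruence_subgroup_2"
  shows "- A \<in> congruence_subgroup_2"
proof -
  from assms obtain a b c d where A: "A = mk2_int a b c d"
    and parity: "odd a" "even b" "even c" "odd d"
    by (rule congruence_subgroup_2_cases)
  have "- A = mk2_int (- a) (- b) (- c) (- d)"
    by (simp add: A mat2_eq_iff)
  moreover have "- A \<in> SL2"
    using assms by (simp add: congruence_subgroup_2_def SL2_uminus)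
  ultimately show ?thesis
    using parity mk2_mem_congruence_subgroup_2[of "- a" "- b" "- c" "- d"] by simp
qed

lemma congruence_subgroup_2_mult:
  assumes "A \<in> congruence_subgroup_2" "B \<in> congruence_subgroup_2"
  shows "A ** B \<in> congruence_subgroup_2"
proof -
  from assms(1) obtain a b c d where A: "A = mk2_int a b c d"
    and A_parity: "odd a" "even b" "even c" "odd d"
    by (rule congruence_subgroup_2_cases)
  from assms(2) obtain a' b' c' d' where B: "B = mk2_int a' b' c' d'"
    and B_parity: "odd a'" "even b'" "even c'" "odd d'"
    by (rule congruence_subgroup_2_cases)
  have AB: "A ** B = mk2_int (a * a' + b * c') (a * b' + b * d') (c * a' + d * c') (c * b' + d * d')"
    by (simp add: A B mat2_eq_iff mat2_mult_nth)
  have "A ** B \<in> SL2"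
    using assms by (simp add: congruence_subgroup_2_def SL2_mult)
  then show ?thesis
    unfolding AB using A_parity B_parity by (intro mk2_mem_congruence_subgroup_2) simp_all
qed

text \<open>The trace is congruent to 2 modulo 4, so there are no elliptic elements.\<close>
lemma congruence_subgroup_2_trace:
  assumes "A \<in> congruence_subgroup_2"
  shows "2 \<le> \<bar>A$1$1 + A$2$2\<bar>"
proof -
  from assms obtain a b c d where A: "A = mk2_int a b c d"
    and parity: "odd a" "even b" "even c" "odd d" and det: "a * d - b * c = 1"
    by (rule congruence_subgroup_2_cases)
  from parity obtain a' b' c' d'
    where halves: "a = 2 * a' + 1" "b = 2 * b'" "c = 2 * c'" "d = 2 * d' + 1"
    by (metis evenE oddE)
  have "a' + d' = 2 * (b' * c' - a' * d')"
    using det unfolding halves by (simp add: algebra_simps)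
  then have "2 \<le> \<bar>a + d\<bar>" unfolding halves by presburger
  then have "2 \<le> \<bar>real_of_int a + of_int d\<bar>" by linarith
  then show ?thesis by (simp add: A)
qed

text \<open>By Cayley--Hamilton the powers are \<open>p\<^sub>n A - p\<^sub>n\<^sub>-\<^sub>1 I\<close>,
  with \<open>|p\<^sub>n|\<close> strictly increasing as \<open>|tr A| \<ge> 2\<close>.\<close>
lemma mpow_Suc_eq_diff:
  fixes A :: mat2
  assumes "A \<in> SL2" "2 \<le> \<bar>A$1$1 + A$2$2\<bar>"
  shows "\<exists>p q. \<bar>q\<bar> + 1 \<le> \<bar>p\<bar> \<and> mpow A (Suc n) = p *\<^sub>R A - q *\<^sub>R mat 1"
proof (induction n)
  case 0
  then show ?case by (intro exI[of _ 1] exI[of _ 0]) simp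
next
  case (Suc n)
  then obtain p q where pq: "\<bar>q\<bar> + 1 \<le> \<bar>p\<bar>" "mpow A (Suc n) = p *\<^sub>R A - q *\<^sub>R mat 1" by blast
  let ?t = "A$1$1 + A$2$2"
  have det: "A$1$2 * A$2$1 = A$1$1 * A$2$2 - 1" "A$2$1 * A$1$2 = A$1$1 * A$2$2 - 1"
    using assms(1) by (simp_all add: mem_SL2_iff mult.commute)
  have "mpow A (Suc (Suc n)) = A ** (p *\<^sub>R A - q *\<^sub>R mat 1)"
    using pq(2) by simp
  also have "\<dots> = (?t * p - q) *\<^sub>R A - p *\<^sub>R mat 1"
    using det by (simp add: mat2_eq_iff mat2_mult_nth) (simp add: algebra_simps, algebra)
  finally have "mpow A (Suc (Suc n)) = (?t * p - q) *\<^sub>R A - p *\<^sub>R mat 1" .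
  moreover have "2 * \<bar>p\<bar> \<le> \<bar>?t * p\<bar>"
    unfolding abs_mult using assms(2) by (intro mult_right_mono) auto
  then have "\<bar>p\<bar> + 1 \<le> \<bar>?t * p - q\<bar>"
    using pq(1) by linarith
  ultimately show ?case by blast
qed

lemma eq_mat_1_if_mpow_eq_mat_1:
  assumes "A \<in> SL2" "2 \<le> \<bar>A$1$1 + A$2$2\<bar>" "0 < n" "mpow A n \<in> {mat 1, - mat 1}"
  shows "A \<in> {mat 1, - mat 1}"
proof -
  obtain p q where "\<bar>q\<bar> + 1 \<le> \<bar>p\<bar>" and pow: "mpow A n = p *\<^sub>R A - q *\<^sub>R mat 1"
    using mpow_Suc_eq_diff[OF assms(1,2), of "n - 1"] \<open>0 < n\<close> by auto
  then have "p \<noteq> 0" by auto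
  obtain e :: real where "p *\<^sub>R A - q *\<^sub>R mat 1 = e *\<^sub>R mat 1"
    using assms(4) unfolding pow by (metis insertE scaleR_minus1_left scaleR_one singletonD)
  then have "A$1$2 = 0" "A$2$1 = 0" "p * A$1$1 = p * A$2$2"
    using \<open>p \<noteq> 0\<close> by (auto simp: mat2_eq_iff algebra_simps)
  then have diagonal: "A$1$2 = 0" "A$2$1 = 0" "A$1$1 = A$2$2"
    using \<open>p \<noteq> 0\<close> by simp_all
  then have "A$1$1 = 1 \<or> A$1$1 = -1"
    using assms(1) by (simp add: mem_SL2_iff square_eq_1_iff)
  with diagonal show ?thesis by (auto simp: mat2_eq_iff)
qed

lemma fuchsian_if_subset_congruence_subgroup_2:
  assumes "psl2_subgroup G" "G \<subseteq> congruence_subgroup_2"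
  shows "fuchsian G"
proof -
  have integral: "A $ i $ j \<in> \<int>" if "A \<in> congruence_subgroup_2" for A i j
    using that by (rule congruence_subgroup_2_cases) (use exhaust_2[of i] exhaust_2[of j] in auto)
  have "1 \<le> norm (A - mat 1)" if "A \<in> G" "A \<noteq> mat 1" for A
    using that assms(2) congruence_subgroup_2_mat_1
    by (intro norm_diff_integral_matrix_ge_1 integral) auto
  then show ?thesis
    unfolding fuchsian_def using assms(1) zero_less_one by blast
qed

lemma torsion_free_if_subset_congruence_subgroup_2:
  assumes "G \<subseteq> congruence_subgroup_2"
  shows "torsion_free G"
  unfolding torsion_free_def
proof (intro ballI allI impI)
  fix A and n :: nat
  assume "A \<in> G" "0 < n" and pow: "mpow A n \<in> {mat 1, - mat 1}"
  then have A: "A \<in> congruence_subgroup_2" using assms by blast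
  then have "A \<in> SL2" by (simp add: congruence_subgroup_2_def)
  then show "A \<in> {mat 1, - mat 1}"
    using congruence_subgroup_2_trace[OF A] \<open>0 < n\<close> pow by (rule eq_mat_1_if_mpow_eq_mat_1)
qed

section \<open>Words\<close>

definition word :: "mat2 list \<Rightarrow> mat2" where
  "word ws = foldr (**) ws (mat 1)"

definition signed_words :: "mat2 set \<Rightarrow> mat2 set" where
  "signed_words S = {A. \<exists>ws\<in>lists S. A = word ws \<or> A = - word ws}"

lemma word_simps [simp]: "word [] = mat 1" "word (A # ws) = A ** word ws"
  by (simp_all add: word_def)

lemma word_append: "word (us @ vs) = word us ** word vs"
  by (induction us) (simp_all add: matrix_mul_assoc)

lemma word_mult_inverse_word:
  assumes "ws \<in> lists SL2"
  shows "word ws ** word (rev (map matrix_inv ws)) = mat 1"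
  using assms
proof (induction ws rule: lists.induct)
  case (Cons A ws)
  have "word (A # ws) ** word (rev (map matrix_inv (A # ws)))
      = A ** (word ws ** word (rev (map matrix_inv ws))) ** matrix_inv A"
    by (simp add: word_append matrix_mul_assoc)
  then show ?case
    using Cons by (simp add: matrix_inv_right_SL2)
qed simp

lemma signed_words_mono: "S \<subseteq> T \<Longrightarrow> signed_words S \<subseteq> signed_words T"
  unfolding signed_words_def using lists_mono by blast

lemma word_mem_signed_words: "ws \<in> lists S \<Longrightarrow> word ws \<in> signed_words S"
  unfolding signed_words_def by blast

lemma generator_mem_signed_words: "A \<in> S \<Longrightarrow> A \<in> signed_words S"
  using word_mem_signed_words[of "[A]"] by simp

lemma mat_1_mem_signed_words: "mat 1 \<in> signed_words S" "- mat 1 \<in> signed_words S"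
  unfolding signed_words_def by (auto intro: bexI[of _ "[]"])

lemma signed_words_mult:
  assumes "A \<in> signed_words S" "B \<in> signed_words S"
  shows "A ** B \<in> signed_words S"
proof -
  obtain us vs where "us \<in> lists S" "A = word us \<or> A = - word us"
    and "vs \<in> lists S" "B = word vs \<or> B = - word vs"
    using assms unfolding signed_words_def by blast
  then show ?thesis
    unfolding signed_words_def
    by (intro CollectI bexI[of _ "us @ vs"])
       (auto simp: word_append matrix_mult_uminus_left matrix_mult_uminus_right)
qed

lemma signed_words_matrix_inv:
  assumes "S \<subseteq> SL2" "matrix_inv ` S \<subseteq> S" "A \<in> signed_words S"
  shows "matrix_inv A \<in> signed_words S"
proof -
  obtain ws where ws: "ws \<in> lists S" "A = word ws \<or> A = - word ws"
    using assms(3) unfolding signed_words_def by blast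
  let ?vs = "rev (map matrix_inv ws)"
  have "word ws ** word ?vs = mat 1"
    using ws(1) assms(1) by (intro word_mult_inverse_word) auto
  then have "A ** word ?vs = mat 1 \<or> A ** (- word ?vs) = mat 1"
    using ws(2) by (auto simp: matrix_mult_uminus_left matrix_mult_uminus_right)
  then have "matrix_inv A = word ?vs \<or> matrix_inv A = - word ?vs"
    using matrix_inv_unique by blast
  moreover have "?vs \<in> lists S"
    using ws(1) assms(2) by (auto simp: image_subset_iff)
  ultimately show ?thesis
    unfolding signed_words_def by blast
qed

lemma signed_words_subset:
  assumes "S \<subseteq> H" "mat 1 \<in> H" "\<And>A. A \<in> H \<Longrightarrow> - A \<in> H" "\<And>A B. A \<in> H \<Longrightarrow> B \<in> H \<Longrightarrow> A ** B \<in> H"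
  shows "signed_words S \<subseteq> H"
proof -
  have "word ws \<in> H" if "ws \<in> lists S" for ws
    using that assms(1,2,4) by (induction ws) auto
  then show ?thesis
    unfolding signed_words_def using assms(3) by auto
qed

lemma psl2_subgroup_signed_words:
  assumes "S \<subseteq> SL2" "matrix_inv ` S \<subseteq> S"
  shows "psl2_subgroup (signed_words S)"
proof -
  have "signed_words S \<subseteq> SL2"
    using assms(1) by (rule signed_words_subset) (simp_all add: SL2_mat_1 SL2_uminus SL2_mult)
  then show ?thesis
    unfolding psl2_subgroup_def sl2_subgroup_def
    using assms by (simp add: mat_1_mem_signed_words signed_words_mult signed_words_matrix_inv)
qed

lemma countable_signed_words:
  assumes "countable S"
  shows "countable (signed_words S)"
proof -
  have "signed_words S = word ` lists S \<union> (\<lambda>ws. - word ws) ` lists S"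
    by (auto simp: signed_words_def)
  then show ?thesis
    using assms by simp
qed

lemma finite_subset_signed_words:
  assumes "finite X" "X \<subseteq> signed_words S"
  shows "\<exists>L\<subseteq>S. finite L \<and> X \<subseteq> signed_words L"
proof -
  have "\<forall>A\<in>X. \<exists>ws. set ws \<subseteq> S \<and> A \<in> signed_words (set ws)"
    using assms(2) by (fastforce simp: signed_words_def)
  then obtain ws where ws: "\<And>A. A \<in> X \<Longrightarrow> set (ws A) \<subseteq> S" "\<And>A. A \<in> X \<Longrightarrow> A \<in> signed_words (set (ws A))"
    by metis
  have "X \<subseteq> signed_words (\<Union>A\<in>X. set (ws A))"
  proof
    fix A assume "A \<in> X"
    then have "signed_words (set (ws A)) \<subseteq> signed_words (\<Union>A\<in>X. set (ws A))"
      by (intro signed_words_mono) blast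
    with ws(2)[OF \<open>A \<in> X\<close>] show "A \<in> signed_words (\<Union>A\<in>X. set (ws A))"
      by blast
  qed
  with ws(1) \<open>finite X\<close> show ?thesis
    by (intro exI[of _ "\<Union>A\<in>X. set (ws A)"]) auto
qed

lemma ex_reduced_word:
  assumes "ws \<in> lists SL2"
  shows "\<exists>vs. set vs \<subseteq> set ws \<and> successively (\<lambda>A B. B \<noteq> matrix_inv A) vs \<and> word vs = word ws"
  using assms
proof (induction ws rule: lists.induct)
  case (Cons A ws)
  then obtain vs
    where vs: "set vs \<subseteq> set ws" "successively (\<lambda>A B. B \<noteq> matrix_inv A) vs" "word vs = word ws"
    by auto
  show ?case
  proof (cases "vs \<noteq> [] \<and> hd vs = matrix_inv A")
    case True
    then obtain us where us: "vs = matrix_inv A # us"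
      by (metis list.collapse)
    have "word (A # ws) = A ** (matrix_inv A ** word us)"
      using vs(3) by (simp add: us)
    also have "\<dots> = word us"
      by (simp add: matrix_mul_assoc matrix_inv_right_SL2[OF Cons.hyps(1)])
    finally have "word us = word (A # ws)" ..
    moreover have "successively (\<lambda>A B. B \<noteq> matrix_inv A) us"
      using vs(2) unfolding us by (cases us) auto
    ultimately show ?thesis
      using us vs(1) by (intro exI[of _ us]) auto
  next
    case False
    then have "successively (\<lambda>A B. B \<noteq> matrix_inv A) (A # vs)"
      using vs(2) by (cases vs) auto
    then show ?thesis
      using vs by (intro exI[of _ "A # vs"]) auto
  qed
qed auto

section \<open>Schottky generators\<close>

lemma closed_UN_separated:
  fixes X :: "'i \<Rightarrow> 'a::metric_space set"
  assumes "\<And>i. i \<in> I \<Longrightarrow> closed (X i)" "0 < \<delta>"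
    and separated: "\<And>i j x y. i \<in> I \<Longrightarrow> j \<in> I \<Longrightarrow> i \<noteq> j \<Longrightarrow> x \<in> X i \<Longrightarrow> y \<in> X j \<Longrightarrow> \<delta> \<le> dist x y"
  shows "closed (\<Union>i\<in>I. X i)"
proof -
  have "x \<in> (\<Union>i\<in>I. X i)" if x: "x \<in> closure (\<Union>i\<in>I. X i)" for x
  proof -
    obtain i y where y: "i \<in> I" "y \<in> X i" "dist y x < \<delta> / 2"
      using x \<open>0 < \<delta>\<close> unfolding closure_approachable by (metis UN_E half_gt_zero)
    have "\<exists>z\<in>X i. dist z x < \<epsilon>" if "0 < \<epsilon>" for \<epsilon>
    proof -
      obtain j z where z: "j \<in> I" "z \<in> X j" "dist z x < min \<epsilon> (\<delta> / 2)"
        using x \<open>0 < \<delta>\<close> \<open>0 < \<epsilon>\<close> unfolding closure_approachable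
        by (metis UN_E half_gt_zero min_less_iff_conj)
      then have "dist y z < \<delta>"
        using y(3) dist_triangle_half_l[of y x \<delta> z] by (simp add: dist_commute)
      then have "i = j"
        using separated y z by (meson not_le)
      with z show ?thesis by auto
    qed
    then have "x \<in> closure (X i)"
      by (simp add: closure_approachable)
    with assms(1) y(1) show ?thesis by (auto simp: closure_closed)
  qed
  then show ?thesis
    by (metis closure_subset closure_closed subset_antisym subsetI closed_closure)
qed

lemma cmod_ii_diff_of_real_ge_1: "1 \<le> cmod (\<i> - of_real x)"
  using abs_Im_le_cmod[of "\<i> - of_real x"] by simp

lemma ii_uhp: "\<i> \<in> uhp"
  by (simp add: uhp_def)

locale schottky_generators =
  fixes S :: "mat2 set"
  assumes generators_SL2: "S \<subseteq> SL2"
    and matrix_inv_generator: "A \<in> S \<Longrightarrow> matrix_inv A \<in> S"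
    and abs_lower_left_ge_2: "A \<in> S \<Longrightarrow> 2 \<le> \<bar>A$2$1\<bar>"
    and centres_separated: "A \<in> S \<Longrightarrow> B \<in> S \<Longrightarrow> A \<noteq> B \<Longrightarrow> 3/2 \<le> \<bar>centre A - centre B\<bar>"
begin

abbreviation \<Gamma> :: "mat2 set" where
  "\<Gamma> \<equiv> signed_words S"

lemma psl2_subgroup_\<Gamma>: "psl2_subgroup \<Gamma>"
  using generators_SL2 matrix_inv_generator by (intro psl2_subgroup_signed_words) auto

lemma sl2_subgroup_\<Gamma>: "sl2_subgroup \<Gamma>"
  using psl2_subgroup_\<Gamma> by (simp add: psl2_subgroup_def)

lemma \<Gamma>_SL2: "\<Gamma> \<subseteq> SL2"
  using sl2_subgroup_\<Gamma> by (simp add: sl2_subgroup_def)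

lemma generator_SL2: "A \<in> S \<Longrightarrow> A \<in> SL2"
  using generators_SL2 by blast

lemma lower_left_neq_0: "A \<in> S \<Longrightarrow> A$2$1 \<noteq> 0"
  using abs_lower_left_ge_2[of A] by auto

lemma disc_radius_le: "A \<in> S \<Longrightarrow> 1 / (A$2$1)\<^sup>2 \<le> 1/4"
  using power_mono[OF abs_lower_left_ge_2, of A 2] by (simp add: divide_simps)

lemma disc_far_from_centre:
  fixes z :: "'a::real_normed_field"
  assumes "A \<in> S" "B \<in> S" "A \<noteq> B" "z \<in> disc A"
  shows "5/4 \<le> norm (z - of_real (centre B))"
proof -
  have "3/2 \<le> norm (of_real (centre A) - of_real (centre B) :: 'a)"
    using centres_separated[OF assms(1-3)] by (simp flip: of_real_diff)
  also have "\<dots> \<le> norm (z - of_real (centre A)) + norm (z - of_real (centre B))"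
    by (metis dist_norm dist_triangle3)
  finally show ?thesis
    using assms(4) disc_radius_le[OF assms(1)] by (simp add: mem_disc_iff)
qed

lemma discs_separated:
  fixes z w :: "'a::real_normed_field"
  assumes "A \<in> S" "B \<in> S" "A \<noteq> B" "z \<in> disc A" "w \<in> disc B"
  shows "1 \<le> dist z w"
proof -
  have "5/4 \<le> norm (z - of_real (centre B))"
    by (rule disc_far_from_centre[OF assms(1-4)])
  also have "\<dots> \<le> dist z w + norm (w - of_real (centre B))"
    by (metis dist_norm dist_triangle)
  finally show ?thesis
    using assms(5) disc_radius_le[OF assms(2)] by (simp add: mem_disc_iff)
qed

lemma ii_notin_disc: "A \<in> S \<Longrightarrow> \<i> \<notin> disc A"
  using disc_radius_le[of A] cmod_ii_diff_of_real_ge_1[of "centre A"] by (auto simp: mem_disc_iff)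

lemma moebius_ii_mem_disc: "A \<in> S \<Longrightarrow> moebius A \<i> \<in> disc A"
  by (intro moebius_mem_disc generator_SL2 lower_left_neq_0)
     (simp_all add: mem_exterior_iff cmod_ii_diff_of_real_ge_1)

lemma moebius_disc_mem_disc:
  fixes z :: "'a::real_normed_field"
  assumes "A \<in> S" "B \<in> S" "B \<noteq> matrix_inv A" "z \<in> disc B"
  shows "moebius A z \<in> disc A"
proof -
  have "5/4 \<le> norm (z - of_real (centre (matrix_inv A)))"
    using assms by (intro disc_far_from_centre[of B] matrix_inv_generator) auto
  then show ?thesis
    using assms(1)
    by (intro moebius_mem_disc generator_SL2 lower_left_neq_0) (auto simp: mem_exterior_iff)
qed

lemma reduced_word_ii_mem_disc:
  assumes "successively (\<lambda>A B. B \<noteq> matrix_inv A) ws" "ws \<noteq> []" "set ws \<subseteq> S"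
  shows "moebius (word ws) \<i> \<in> disc (hd ws)"
  using assms
proof (induction ws)
  case (Cons A ws)
  have "word ws \<in> SL2"
    using Cons.prems word_mem_signed_words[of ws S] \<Gamma>_SL2 by auto
  then have step: "moebius (word (A # ws)) \<i> = moebius A (moebius (word ws) \<i>)"
    by (simp add: moebius_mult denom_uhp ii_uhp)
  show ?case
  proof (cases ws)
    case Nil
    then show ?thesis using Cons.prems by (simp add: moebius_ii_mem_disc)
  next
    case (Cons B us)
    then have "moebius (word ws) \<i> \<in> disc B"
      using Cons.IH Cons.prems by simp
    then show ?thesis
      unfolding step using Cons Cons.prems by (auto intro: moebius_disc_mem_disc[of A B])
  qed
qed simp

lemma signed_words_ii_mem_disc:
  assumes "L \<subseteq> S" "A \<in> signed_words L"
  shows "moebius A \<i> \<in> insert \<i> (\<Union>B\<in>L. disc B)"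
proof -
  obtain ws where ws: "ws \<in> lists L" "A = word ws \<or> A = - word ws"
    using assms(2) by (auto simp: signed_words_def)
  have "ws \<in> lists SL2"
    using ws(1) assms(1) generators_SL2 by auto
  then obtain vs
    where vs: "set vs \<subseteq> set ws" "successively (\<lambda>A B. B \<noteq> matrix_inv A) vs" "word vs = word ws"
    using ex_reduced_word by blast
  have "moebius A \<i> = moebius (word vs) \<i>"
    using ws(2) vs(3) by auto
  moreover have "moebius (word vs) \<i> \<in> insert \<i> (\<Union>B\<in>L. disc B)"
  proof (cases "vs = []")
    case False
    have "set vs \<subseteq> L"
      using vs(1) ws(1) by auto
    moreover from this have "moebius (word vs) \<i> \<in> disc (hd vs)"
      using assms(1) by (intro reduced_word_ii_mem_disc[OF vs(2) False]) blast
    ultimately show ?thesis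
      using hd_in_set[OF False] by blast
  qed simp
  ultimately show ?thesis by simp
qed

lemma not_finitely_generated_\<Gamma>:
  assumes "infinite S"
  shows "\<not> finitely_generated \<Gamma>"
proof
  assume "finitely_generated \<Gamma>"
  then obtain X where "finite X" and \<Gamma>_eq: "\<Gamma> = sl2_generated X"
    by (auto simp: finitely_generated_def)
  moreover have "X \<subseteq> \<Gamma>"
    unfolding \<Gamma>_eq sl2_generated_def by blast
  ultimately obtain L where L: "L \<subseteq> S" "finite L" "X \<subseteq> signed_words L"
    using finite_subset_signed_words by meson
  define M where "M = L \<union> matrix_inv ` L"
  have M: "M \<subseteq> S" "finite M"
    using L matrix_inv_generator by (auto simp: M_def)
  have "matrix_inv (matrix_inv A) = A" if "A \<in> L" for A
    using that L(1) generator_SL2 by (simp add: subset_iff matrix_inv_matrix_inv_SL2)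
  then have "psl2_subgroup (signed_words M)"
    using M(1) generators_SL2 by (intro psl2_subgroup_signed_words) (auto simp: M_def)
  moreover have "X \<subseteq> signed_words M"
    using L(3) signed_words_mono[of L M] by (auto simp: M_def)
  ultimately have \<Gamma>_subset: "\<Gamma> \<subseteq> signed_words M"
    unfolding \<Gamma>_eq sl2_generated_def psl2_subgroup_def by blast
  obtain A where A: "A \<in> S" "A \<notin> M"
    using assms M(2) by (metis finite_subset subsetI)
  then have "moebius A \<i> \<in> insert \<i> (\<Union>B\<in>M. disc B)"
    using \<Gamma>_subset generator_mem_signed_words by (intro signed_words_ii_mem_disc[OF M(1)]) blast
  moreover have "moebius A \<i> \<noteq> \<i>"
    using moebius_ii_mem_disc ii_notin_disc A(1) by metis
  ultimately obtain B where "B \<in> M" "moebius A \<i> \<in> disc B"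
    by auto
  then have "1 \<le> dist (moebius A \<i>) (moebius A \<i>)"
    using A M(1) by (intro discs_separated[of A B] moebius_ii_mem_disc) auto
  then show False by simp
qed

lemma limit_set_subset_discs:
  assumes z: "z \<in> uhp" and x: "Some x \<in> limit_set \<Gamma> z"
  shows "\<exists>A\<in>S. x \<in> disc A"
proof -
  have "Some x \<in> limit_set \<Gamma> \<i>"
    using limit_set_change_basepoint[OF \<Gamma>_SL2 z ii_uhp x] .
  then obtain p where p: "\<And>n. p n \<in> orbit \<Gamma> \<i>" "p \<longlonglongrightarrow> complex_of_real x"
    by (auto simp: limit_set_def conv_bdry_def)
  have "closed (insert \<i> (\<Union>A\<in>S. disc A))"
    by (intro closed_insert closed_UN_separated[of _ _ 1]) (auto simp: discs_separated disc_def)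
  moreover have "p n \<in> insert \<i> (\<Union>A\<in>S. disc A)" for n
  proof -
    obtain A where "A \<in> \<Gamma>" "p n = moebius A \<i>"
      using p(1)[of n] by (auto simp: orbit_eq)
    then show ?thesis
      using signed_words_ii_mem_disc[OF subset_refl] by simp
  qed
  ultimately have "of_real x \<in> insert \<i> (\<Union>A\<in>S. disc A)"
    using p(2) by (rule closed_sequentially)
  moreover have "of_real x \<noteq> \<i>"
    by (simp add: complex_eq_iff)
  ultimately show ?thesis
    by (auto simp: of_real_mem_disc_iff)
qed

section \<open>Itineraries\<close>

definition itinerary :: "(nat \<Rightarrow> mat2) \<Rightarrow> (nat \<Rightarrow> real) \<Rightarrow> bool" where
  "itinerary l y \<longleftrightarrow> (\<forall>k. l k \<in> S \<and> y k \<in> disc (l k) \<and> y k \<noteq> centre (l k) \<and>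
     y (Suc k) = moebius (matrix_inv (l k)) (y k))"

lemma itinerary_letter: "itinerary l y \<Longrightarrow> l k \<in> S"
  by (simp add: itinerary_def)

lemma itinerary_disc: "itinerary l y \<Longrightarrow> y k \<in> disc (l k)"
  by (simp add: itinerary_def)

lemma itinerary_Suc: "itinerary l y \<Longrightarrow> y (Suc k) = moebius (matrix_inv (l k)) (y k)"
  by (simp add: itinerary_def)

lemma itinerary_mem_exterior: "itinerary l y \<Longrightarrow> y (Suc k) \<in> exterior (l k)"
  by (simp add: itinerary_def moebius_matrix_inv_mem_exterior generator_SL2 lower_left_neq_0)

lemma denom_matrix_inv_neq_0:
  assumes "A \<in> S" "x \<noteq> centre A"
  shows "denom (matrix_inv A) x \<noteq> 0"
proof -
  have "denom (matrix_inv A) x = - (A$2$1 * (x - centre A))"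
    using lower_left_neq_0[OF assms(1)]
    by (simp add: denom_def centre_def matrix_inv_SL2[OF generator_SL2[OF assms(1)]] algebra_simps)
  then show ?thesis
    using assms lower_left_neq_0 by simp
qed

lemma moebius_moebius_matrix_inv:
  assumes "A \<in> S" "x \<noteq> centre A"
  shows "denom A (moebius (matrix_inv A) x) \<noteq> 0" "moebius A (moebius (matrix_inv A) x) = x"
  using denom_matrix_inv_moebius[OF SL2_matrix_inv denom_matrix_inv_neq_0[OF assms]]
    moebius_matrix_inv_moebius[OF SL2_matrix_inv denom_matrix_inv_neq_0[OF assms]]
    generator_SL2[OF assms(1)]
  by (simp_all add: matrix_inv_matrix_inv_SL2)

lemma itinerary_denom: "itinerary l y \<Longrightarrow> denom (matrix_inv (l k)) (y k) \<noteq> 0"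
  by (intro denom_matrix_inv_neq_0) (simp_all add: itinerary_def)

lemma itinerary_eq_moebius: "itinerary l y \<Longrightarrow> y k = moebius (l k) (y (Suc k))"
  by (simp add: itinerary_def moebius_moebius_matrix_inv)

lemma itinerary_reduced:
  assumes "itinerary l y"
  shows "l (Suc k) \<noteq> matrix_inv (l k)"
proof
  assume "l (Suc k) = matrix_inv (l k)"
  then have "\<bar>y (Suc k) - centre (matrix_inv (l k))\<bar> \<le> 1/4"
    using itinerary_disc[OF assms, of "Suc k"] disc_radius_le[OF itinerary_letter[OF assms], of "Suc k"]
    by (simp add: mem_disc_iff)
  with itinerary_mem_exterior[OF assms, of k] show False
    by (simp add: mem_exterior_iff)
qed

primrec inverse_prefix :: "(nat \<Rightarrow> mat2) \<Rightarrow> nat \<Rightarrow> mat2" where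
  "inverse_prefix l 0 = mat 1"
| "inverse_prefix l (Suc k) = matrix_inv (l k) ** inverse_prefix l k"

lemma inverse_prefix_mem_\<Gamma>:
  assumes "itinerary l y"
  shows "inverse_prefix l k \<in> \<Gamma>"
proof (induction k)
  case 0
  show ?case by (simp add: mat_1_mem_signed_words)
next
  case (Suc k)
  then show ?case
    using itinerary_letter[OF assms]
    by (simp add: signed_words_mult generator_mem_signed_words matrix_inv_generator)
qed

lemma inverse_prefix_SL2: "itinerary l y \<Longrightarrow> inverse_prefix l k \<in> SL2"
  using inverse_prefix_mem_\<Gamma> \<Gamma>_SL2 by blast

lemma moebius_inverse_prefix_itinerary:
  assumes "itinerary l y"
  shows "denom (inverse_prefix l k) (y 0) \<noteq> 0 \<and> moebius (inverse_prefix l k) (y 0) = y k"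
proof (induction k)
  case (Suc k)
  then show ?case
    using itinerary_denom[OF assms, of k] by (simp add: denom_mult moebius_mult itinerary_Suc[OF assms])
qed simp

definition points_avoiding :: "mat2 set \<Rightarrow> real set" where
  "points_avoiding F = {y 0 | l y. itinerary l y \<and> (\<forall>k. l k \<notin> F)}"

lemma itinerary_mem_points_avoiding:
  assumes "itinerary l y" "\<And>k. n \<le> k \<Longrightarrow> l k \<notin> F"
  shows "y n \<in> points_avoiding F"
proof -
  have "itinerary (\<lambda>k. l (k + n)) (\<lambda>k. y (k + n))"
    using assms(1) by (simp add: itinerary_def)
  then show ?thesis
    unfolding points_avoiding_def using assms(2)
    by (intro CollectI exI[of _ "\<lambda>k. l (k + n)"] exI[of _ "\<lambda>k. y (k + n)"]) simp
qed

lemma points_avoiding_subset_discs: "points_avoiding F \<subseteq> (\<Union>A\<in>S - F. disc A)"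
  by (auto simp: points_avoiding_def dest: itinerary_letter itinerary_disc)

lemma points_avoiding_self_cover:
  "points_avoiding F \<subseteq> (\<Union>A\<in>S - F. moebius A ` (points_avoiding F \<inter> exterior A))"
proof
  fix x assume "x \<in> points_avoiding F"
  then obtain l y where l: "itinerary l y" "\<forall>k. l k \<notin> F" and x: "x = y 0"
    by (auto simp: points_avoiding_def)
  have "y 1 \<in> points_avoiding F"
    using l by (intro itinerary_mem_points_avoiding) auto
  moreover have "y 1 \<in> exterior (l 0)" "x = moebius (l 0) (y 1)"
    using itinerary_mem_exterior[OF l(1), of 0] itinerary_eq_moebius[OF l(1), of 0] x by simp_all
  ultimately show "x \<in> (\<Union>A\<in>S - F. moebius A ` (points_avoiding F \<inter> exterior A))"
    using itinerary_letter[OF l(1), of 0] l(2) by blast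
qed

lemma countable_generators:
  assumes "(\<lambda>A. (1 / (A$2$1)\<^sup>2) powr s) summable_on S"
  shows "countable S"
proof -
  have "{A\<in>S. (1 / (A$2$1)\<^sup>2) powr s \<noteq> 0} = S"
    using lower_left_neq_0 by auto
  then show ?thesis
    using summable_countable_real[OF assms] by simp
qed

lemma ex_finite_hausdorff_content_points_avoiding_eq_0:
  assumes "0 < s" and summable: "(\<lambda>A. (1 / (A$2$1)\<^sup>2) powr s) summable_on S"
  shows "\<exists>F\<subseteq>S. finite F \<and> hausdorff_content s (points_avoiding F) = 0"
proof -
  let ?\<rho> = "\<lambda>A :: mat2. 1 / (A$2$1)\<^sup>2"
  obtain F where F: "finite F" "F \<subseteq> S"
    and tail: "(\<integral>\<^sup>+A. ennreal (?\<rho> A powr s) \<partial>count_space (S - F)) < ennreal 1"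
    by (rule nn_integral_count_space_small_tail[OF summable, of 1]) auto
  have countable: "countable (S - F)"
    using countable_generators[OF summable] by simp
  have "hausdorff_content s (points_avoiding F) \<le> hausdorff_content s (\<Union>A\<in>S - F. disc A :: real set)"
    by (rule hausdorff_content_mono[OF points_avoiding_subset_discs])
  also have "\<dots> \<le> (\<integral>\<^sup>+A. hausdorff_content s (disc A :: real set) \<partial>count_space (S - F))"
    by (rule hausdorff_content_UN[OF countable])
  also have "\<dots> \<le> (\<integral>\<^sup>+A. ennreal (2 powr s) * ennreal (?\<rho> A powr s) \<partial>count_space (S - F))"
    by (intro nn_integral_mono hausdorff_content_disc_le)
  also have "\<dots> = ennreal (2 powr s) * (\<integral>\<^sup>+A. ennreal (?\<rho> A powr s) \<partial>count_space (S - F))"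
    by (rule nn_integral_cmult) simp
  also have "\<dots> < \<infinity>"
    using less_trans[OF tail ennreal_less_top] by (simp add: ennreal_mult_less_top)
  finally have finite_content: "hausdorff_content s (points_avoiding F) < \<infinity>" .
  have "(?\<rho> A)-lipschitz_on (exterior A :: real set) (moebius A)" if "A \<in> S" for A
    using that by (intro lipschitz_on_moebius_exterior generator_SL2 lower_left_neq_0)
  then have "hausdorff_content s (points_avoiding F) = 0"
    using \<open>0 < s\<close> tail lower_left_neq_0
    by (intro hausdorff_content_self_cover_eq_0[OF _ countable finite_content
          points_avoiding_self_cover, where \<rho> = ?\<rho>]) auto
  with F show ?thesis by blast
qed

lemma itinerary_mem_translates:
  assumes itinerary: "itinerary l y" and "\<forall>\<^sub>F k in sequentially. l k \<notin> F"
  shows "y 0 \<in> translates \<Gamma> (points_avoiding F)"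
proof -
  obtain K where K: "\<And>k. K \<le> k \<Longrightarrow> l k \<notin> F"
    using assms(2) by (auto simp: eventually_sequentially)
  have "y K \<in> points_avoiding F"
    using itinerary K by (rule itinerary_mem_points_avoiding)
  then have tail: "y K \<in> translates \<Gamma> (points_avoiding F)"
    using subset_translates[OF mat_1_mem_signed_words(1)] by blast
  let ?H = "inverse_prefix l K"
  have "?H \<in> SL2" "denom ?H (y 0) \<noteq> 0" "y K = moebius ?H (y 0)"
    using inverse_prefix_SL2[OF itinerary] moebius_inverse_prefix_itinerary[OF itinerary] by auto
  then have "denom (matrix_inv ?H) (y K) \<noteq> 0" "moebius (matrix_inv ?H) (y K) = y 0"
    by (simp_all add: denom_matrix_inv_moebius moebius_matrix_inv_moebius)
  moreover have "matrix_inv ?H \<in> \<Gamma>"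
    using sl2_subgroup_\<Gamma> inverse_prefix_mem_\<Gamma>[OF itinerary] by (simp add: sl2_subgroup_def)
  ultimately show ?thesis
    using moebius_mem_translates[OF sl2_subgroup_\<Gamma> _ _ tail] by metis
qed

text \<open>The excluded points are those of \<open>\<Gamma>\<infinity>\<close>, whose itineraries terminate.\<close>
lemma ex_itinerary:
  assumes z: "z \<in> uhp" and x: "Some x \<in> limit_set \<Gamma> z" "x \<notin> translates \<Gamma> (centre ` S)"
  shows "\<exists>l y. itinerary l y \<and> y 0 = x"
proof -
  define P where "P u \<longleftrightarrow> Some u \<in> limit_set \<Gamma> z \<and> u \<notin> translates \<Gamma> (centre ` S)" for u
  have "\<exists>A\<in>S. u \<in> disc A \<and> u \<noteq> centre A \<and> P (moebius (matrix_inv A) u)" if "P u" for u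
  proof -
    have u: "Some u \<in> limit_set \<Gamma> z" "u \<notin> translates \<Gamma> (centre ` S)"
      using that by (simp_all add: P_def)
    obtain A where A: "A \<in> S" "u \<in> disc A"
      using limit_set_subset_discs[OF z u(1)] by blast
    have "u \<noteq> centre A"
      using u(2) A(1) subset_translates[OF mat_1_mem_signed_words(1), of "centre ` S" S] by auto
    moreover have "Some (moebius (matrix_inv A) u) \<in> limit_set \<Gamma> z"
      using A(1) \<open>u \<noteq> centre A\<close> u(1)
      by (intro limit_set_moebius sl2_subgroup_\<Gamma> generator_mem_signed_words matrix_inv_generator z
          denom_matrix_inv_neq_0)
    moreover have "moebius (matrix_inv A) u \<notin> translates \<Gamma> (centre ` S)"
      using moebius_mem_translates[OF sl2_subgroup_\<Gamma> generator_mem_signed_words[OF A(1)]]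
        moebius_moebius_matrix_inv[OF A(1) \<open>u \<noteq> centre A\<close>] u(2) by metis
    ultimately show ?thesis
      using A by (auto simp: P_def)
  qed
  then obtain a
    where a: "\<And>u. P u \<Longrightarrow> a u \<in> S \<and> u \<in> disc (a u) \<and> u \<noteq> centre (a u) \<and> P (moebius (matrix_inv (a u)) u)"
    by metis
  define y where "y k = ((\<lambda>u. moebius (matrix_inv (a u)) u) ^^ k) x" for k
  have "P (y k)" for k
    by (induction k) (use x a in \<open>simp_all add: y_def P_def\<close>)
  then have "itinerary (\<lambda>k. a (y k)) y"
    using a by (simp add: itinerary_def y_def)
  then show ?thesis
    by (intro exI[of _ "\<lambda>k. a (y k)"] exI[of _ y]) (simp add: y_def)
qed

section \<open>Recurrence\<close>

definition base_image :: "(nat \<Rightarrow> mat2) \<Rightarrow> nat \<Rightarrow> complex" where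
  "base_image l k = moebius (inverse_prefix l k) \<i>"

lemma base_image_uhp: "itinerary l y \<Longrightarrow> base_image l k \<in> uhp"
  by (simp add: base_image_def moebius_uhp inverse_prefix_SL2 ii_uhp)

lemma base_image_0: "base_image l 0 = \<i>"
  by (simp add: base_image_def)

lemma base_image_Suc:
  assumes "itinerary l y"
  shows "base_image l (Suc k) = moebius (matrix_inv (l k)) (base_image l k)"
  by (simp add: base_image_def moebius_mult denom_uhp[OF inverse_prefix_SL2[OF assms] ii_uhp])

lemma base_image_mem_disc:
  assumes itinerary: "itinerary l y"
  shows "base_image l (Suc k) \<in> disc (matrix_inv (l k))"
proof (induction k)
  case 0
  show ?case
    using itinerary_letter[OF itinerary]
    by (simp add: base_image_Suc[OF itinerary] base_image_0 moebius_ii_mem_disc matrix_inv_generator)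
next
  case (Suc k)
  have "matrix_inv (l k) \<noteq> matrix_inv (matrix_inv (l (Suc k)))"
    using itinerary_reduced[OF itinerary, of k] generator_SL2[OF itinerary_letter[OF itinerary]]
    by (simp add: matrix_inv_matrix_inv_SL2)
  with Suc show ?case
    unfolding base_image_Suc[OF itinerary, of "Suc k"] using itinerary_letter[OF itinerary]
    by (intro moebius_disc_mem_disc[of "matrix_inv (l (Suc k))" "matrix_inv (l k)"])
       (simp_all add: matrix_inv_generator)
qed

lemma base_image_far:
  assumes itinerary: "itinerary l y"
  shows "1 \<le> cmod (base_image l k - of_real (centre (l k)))"
proof (cases k)
  case 0
  then show ?thesis
    by (simp add: base_image_0 cmod_ii_diff_of_real_ge_1)
next
  case (Suc j)
  then have "base_image l k \<in> disc (matrix_inv (l j))" "matrix_inv (l j) \<noteq> l k"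
    using base_image_mem_disc[OF itinerary] itinerary_reduced[OF itinerary, of j] by simp_all
  then have "5/4 \<le> cmod (base_image l k - of_real (centre (l k)))"
    using itinerary_letter[OF itinerary]
    by (intro disc_far_from_centre[of "matrix_inv (l j)"] matrix_inv_generator)
  then show ?thesis by simp
qed

lemma Im_base_image_le:
  assumes itinerary: "itinerary l y"
  shows "Im (base_image l k) \<le> (1/4) ^ k"
proof (induction k)
  case 0
  show ?case by (simp add: base_image_0)
next
  case (Suc k)
  let ?B = "matrix_inv (l k)" and ?z = "base_image l k"
  have letters: "?B \<in> S" "l k \<in> S"
    using itinerary_letter[OF itinerary] by (simp_all add: matrix_inv_generator)
  have "2 * 1 \<le> \<bar>?B$2$1\<bar> * cmod (?z - of_real (centre (l k)))"
    using abs_lower_left_ge_2[OF letters(1)] base_image_far[OF itinerary] by (intro mult_mono) auto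
  also have "\<dots> = cmod (denom ?B ?z)"
    using letters by (simp add: norm_denom generator_SL2 lower_left_neq_0 matrix_inv_matrix_inv_SL2)
  finally have "2\<^sup>2 \<le> (cmod (denom ?B ?z))\<^sup>2"
    by (intro power_mono) auto
  moreover have "0 \<le> Im ?z"
    using base_image_uhp[OF itinerary] by (simp add: uhp_def less_imp_le)
  ultimately have "Im ?z / (cmod (denom ?B ?z))\<^sup>2 \<le> Im ?z / 2\<^sup>2"
    by (intro frac_le) auto
  then have "Im (base_image l (Suc k)) \<le> Im ?z / 2\<^sup>2"
    unfolding base_image_Suc[OF itinerary] Im_moebius[OF generator_SL2[OF letters(1)]] .
  with Suc show ?case by simp
qed

lemma cosh_hdist_ray_base_image_le:
  fixes k :: nat
  assumes itinerary: "itinerary l y"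
  defines "z \<equiv> base_image l (Suc k)" and "r \<equiv> centre (matrix_inv (l k))"
  shows "cosh (hdist (ray z (y (Suc k)) (- ln (Im z))) \<i>) \<le> 5/2 * ((\<bar>r\<bar> + 1)\<^sup>2 + 2)"
proof -
  define w where "w = ray z (y (Suc k)) (- ln (Im z))"
  have z: "z \<in> uhp"
    unfolding z_def by (rule base_image_uhp[OF itinerary])
  have "(1/4 :: real) ^ Suc k \<le> 1"
    by (rule power_le_one) auto
  then have "Im z \<le> 1"
    using Im_base_image_le[OF itinerary, of "Suc k"] unfolding z_def by linarith
  have "cmod (z - of_real r) \<le> 1/4"
    using base_image_mem_disc[OF itinerary, of k]
      disc_radius_le[OF matrix_inv_generator[OF itinerary_letter[OF itinerary]]]
    unfolding mem_disc_iff z_def r_def by (rule order_trans)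
  then have Re_z: "\<bar>Re z - r\<bar> \<le> 1/4"
    using abs_Re_le_cmod[of "z - of_real r"] by simp
  moreover have "1 \<le> \<bar>y (Suc k) - r\<bar>"
    using itinerary_mem_exterior[OF itinerary, of k] by (simp add: mem_exterior_iff r_def)
  ultimately have "1/2 \<le> \<bar>y (Suc k) - Re z\<bar>"
    by linarith
  note w = ray_at_unit_height[OF z \<open>Im z \<le> 1\<close> this, folded w_def]
  have "\<bar>Re w\<bar> \<le> \<bar>r\<bar> + 1"
    using w(3) Re_z by linarith
  then have "(Re w)\<^sup>2 \<le> (\<bar>r\<bar> + 1)\<^sup>2"
    by (metis abs_ge_zero power2_abs power_mono)
  moreover have "(Im w)\<^sup>2 \<le> 1"
    using w(1,2) by (intro power_le_one) auto
  ultimately have "((Re w)\<^sup>2 + (Im w)\<^sup>2 + 1) / (2 * Im w) \<le> ((\<bar>r\<bar> + 1)\<^sup>2 + 1 + 1) / (2 * (1/5))"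
    using w(1) by (intro frac_le add_mono) auto
  moreover have "w \<in> uhp"
    using w(1) by (simp add: uhp_def)
  ultimately show ?thesis
    by (simp add: cosh_hdist ii_uhp flip: w_def)
qed

lemma neg_ln_Im_base_image_tendsto_infinity:
  assumes itinerary: "itinerary l y"
  shows "filterlim (\<lambda>k. - ln (Im (base_image l k))) at_top sequentially"
proof -
  have Im_pos: "0 < Im (base_image l k)" for k
    using base_image_uhp[OF itinerary] by (simp add: uhp_def)
  then have "(\<lambda>k. Im (base_image l k)) \<longlonglongrightarrow> 0"
    using Im_base_image_le[OF itinerary]
    by (intro tendsto_sandwich[OF _ _ tendsto_const LIMSEQ_realpow_zero[of "1/4"]])
       (auto intro!: always_eventually less_imp_le)
  then have "filterlim (\<lambda>k. Im (base_image l k)) (at_right 0) sequentially"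
    using Im_pos by (simp add: filterlim_at less_imp_neq[symmetric])
  then show ?thesis
    by (intro filterlim_compose[OF filterlim_uminus_at_top_at_bot] filterlim_compose[OF ln_at_0])
qed

lemma moebius_inverse_prefix_ray:
  assumes "itinerary l y"
  shows "moebius (inverse_prefix l k) (ray \<i> (y 0) t) = ray (base_image l k) (y k) t"
  using moebius_ray[OF inverse_prefix_SL2[OF assms] _ ii_uhp, of k "y 0" t]
    moebius_inverse_prefix_itinerary[OF assms, of k]
  by (simp add: base_image_def)

text \<open>A letter that recurs brings the ray back to a bounded part of the quotient each time.\<close>
lemma transient_itinerary_eventually_neq:
  assumes itinerary: "itinerary l y" and z: "z \<in> uhp"
    and transient: "Some (y 0) \<in> transient_limit_set \<Gamma> z"
  shows "\<forall>\<^sub>F k in sequentially. l k \<noteq> A"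
proof -
  define C where "C = 5/2 * ((\<bar>centre (matrix_inv A)\<bar> + 1)\<^sup>2 + 2)"
  define t where "t k = - ln (Im (base_image l (Suc k)))" for k
  have "filterlim t at_top sequentially"
    unfolding t_def using neg_ln_Im_base_image_tendsto_infinity[OF itinerary] filterlim_Suc
    by (rule filterlim_compose)
  with transient_ray_escapes[OF sl2_subgroup_\<Gamma> z ii_uhp transient]
  have "\<forall>\<^sub>F k in sequentially. \<forall>B\<in>\<Gamma>. C < cosh (hdist (moebius B (ray \<i> (y 0) (t k))) \<i>)"
    by (rule eventually_compose_filterlim)
  then show ?thesis
  proof eventually_elim
    case (elim k)
    then have "C < cosh (hdist (ray (base_image l (Suc k)) (y (Suc k)) (t k)) \<i>)"
      using inverse_prefix_mem_\<Gamma>[OF itinerary]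
      unfolding moebius_inverse_prefix_ray[OF itinerary, symmetric] by blast
    then show ?case
      using cosh_hdist_ray_base_image_le[OF itinerary, of k] by (auto simp: C_def t_def)
  qed
qed

lemma transient_limit_set_subset:
  assumes z: "z \<in> uhp" and "finite F"
  shows "{x. Some x \<in> transient_limit_set \<Gamma> z}
    \<subseteq> translates \<Gamma> (centre ` S) \<union> translates \<Gamma> (points_avoiding F)"
proof (intro subsetI)
  fix x assume "x \<in> {x. Some x \<in> transient_limit_set \<Gamma> z}"
  then have transient: "Some x \<in> transient_limit_set \<Gamma> z" by simp
  show "x \<in> translates \<Gamma> (centre ` S) \<union> translates \<Gamma> (points_avoiding F)"
  proof (cases "x \<in> translates \<Gamma> (centre ` S)")
    case False
    moreover have "Some x \<in> limit_set \<Gamma> z"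
      using transient by (simp add: transient_limit_set_def)
    ultimately obtain l y where itinerary: "itinerary l y" and x: "y 0 = x"
      using ex_itinerary[OF z] by blast
    have "\<forall>\<^sub>F k in sequentially. \<forall>A\<in>F. l k \<noteq> A"
      using transient_itinerary_eventually_neq[OF itinerary z] transient x \<open>finite F\<close>
      by (intro eventually_ball_finite) auto
    then have "\<forall>\<^sub>F k in sequentially. l k \<notin> F"
      by (rule eventually_mono) blast
    from itinerary_mem_translates[OF itinerary this] show ?thesis
      by (simp add: x)
  qed simp
qed

theorem bdry_hausdorff_dim_transient_limit_set:
  assumes summable: "\<And>s. 0 < s \<Longrightarrow> (\<lambda>A. (1 / (A$2$1)\<^sup>2) powr s) summable_on S" and z: "z \<in> uhp"
  shows "bdry_hausdorff_dim (transient_limit_set \<Gamma> z) = 0"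
  unfolding bdry_hausdorff_dim_def
proof (rule hausdorff_dim_eq_0)
  fix s :: real assume "0 < s"
  obtain F where "finite F" and F_null: "hausdorff_content s (points_avoiding F) = 0"
    using ex_finite_hausdorff_content_points_avoiding_eq_0[OF \<open>0 < s\<close> summable[OF \<open>0 < s\<close>]] by blast
  have "countable S"
    using countable_generators[OF summable[OF \<open>0 < s\<close>]] .
  then have "hausdorff_content s (centre ` S) = 0"
    by (intro hausdorff_content_countable) simp
  then have "hausdorff_content s (translates \<Gamma> (centre ` S)) = 0"
    "hausdorff_content s (translates \<Gamma> (points_avoiding F)) = 0"
    using F_null \<Gamma>_SL2 countable_signed_words[OF \<open>countable S\<close>] \<open>0 < s\<close>
    by (simp_all add: hausdorff_content_translates_eq_0)
  then have "hausdorff_content s (translates \<Gamma> (centre ` S) \<union> translates \<Gamma> (points_avoiding F)) = 0"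
    by (rule hausdorff_content_Un_eq_0)
  then show "hausdorff_content s {x. Some x \<in> transient_limit_set \<Gamma> z} = 0"
    using transient_limit_set_subset[OF z \<open>finite F\<close>] by (rule hausdorff_content_eq_0_subset)
qed

end

section \<open>The group\<close>

definition lower_coeff :: "int \<Rightarrow> int" where
  "lower_coeff j = sgn j * 2 ^ nat \<bar>j\<bar>"

text \<open>With \<open>T\<close> the unit translation this is \<open>T\<^bsup>2j\<^esup> [[1,0],[c,1]] T\<^bsup>2j\<^esup>\<close> for \<open>c = lower_coeff j\<close>.\<close>
definition level2_generator :: "int \<Rightarrow> mat2" where
  "level2_generator j = (let c = lower_coeff j; m = 2 * j in
     mk2_int (m * c + 1) (m\<^sup>2 * c + 2 * m) c (m * c + 1))"

lemma lower_coeff_uminus: "lower_coeff (- j) = - lower_coeff j"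
  by (simp add: lower_coeff_def)

lemma even_lower_coeff: "even (lower_coeff j)"
  by (cases "j = 0") (auto simp: lower_coeff_def)

lemma abs_lower_coeff: "j \<noteq> 0 \<Longrightarrow> \<bar>real_of_int (lower_coeff j)\<bar> = 2 ^ nat \<bar>j\<bar>"
  by (simp add: lower_coeff_def abs_mult sgn_if)

lemma abs_lower_coeff_ge_2:
  assumes "j \<noteq> 0"
  shows "2 \<le> \<bar>real_of_int (lower_coeff j)\<bar>"
proof -
  have "(2::real) ^ 1 \<le> 2 ^ nat \<bar>j\<bar>"
    using assms by (intro power_increasing) auto
  then show ?thesis by (simp add: abs_lower_coeff[OF assms])
qed

lemma level2_generator_lower_left: "level2_generator j $ 2 $ 1 = of_int (lower_coeff j)"
  by (simp add: level2_generator_def Let_def)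

lemma level2_generator_SL2: "level2_generator j \<in> SL2"
  by (simp add: level2_generator_def Let_def mem_SL2_iff algebra_simps power2_eq_square)

lemma matrix_inv_level2_generator: "matrix_inv (level2_generator j) = level2_generator (- j)"
  by (simp add: matrix_inv_SL2[OF level2_generator_SL2] mat2_eq_iff)
     (simp add: level2_generator_def Let_def lower_coeff_uminus)

lemma level2_generator_mem_congruence_subgroup_2: "level2_generator j \<in> congruence_subgroup_2"
  using level2_generator_SL2[of j] even_lower_coeff[of j] unfolding level2_generator_def Let_def
  by (intro mk2_mem_congruence_subgroup_2) auto

lemma centre_level2_generator:
  assumes "j \<noteq> 0"
  shows "centre (level2_generator j) = 2 * of_int j + 1 / of_int (lower_coeff j)"
proof -
  have "lower_coeff j \<noteq> 0" using abs_lower_coeff_ge_2[OF assms] by auto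
  then show ?thesis
    by (simp add: centre_def level2_generator_def Let_def field_simps)
qed

lemma centre_level2_generator_bounds:
  "0 < j \<Longrightarrow> centre (level2_generator j) \<in> {2 * of_int j<..2 * of_int j + 1/2}"
  "j < 0 \<Longrightarrow> centre (level2_generator j) \<in> {2 * of_int j - 1/2..<2 * of_int j}"
  using abs_lower_coeff_ge_2[of j]
  by (auto simp: centre_level2_generator lower_coeff_def field_simps sgn_if)

lemma centres_level2_generators_separated:
  assumes "j \<noteq> 0" "k \<noteq> 0" "j \<noteq> k"
  shows "3/2 \<le> \<bar>centre (level2_generator j) - centre (level2_generator k)\<bar>"
proof -
  have separated_if_less: "3/2 \<le> centre (level2_generator k) - centre (level2_generator j)"
    if "j \<noteq> 0" "k \<noteq> 0" "j < k" for j k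
  proof -
    have "real_of_int j + 1 \<le> of_int k" using \<open>j < k\<close> by linarith
    then show ?thesis
      using centre_level2_generator_bounds[of j] centre_level2_generator_bounds[of k] that
      by (cases "0 < j"; cases "0 < k") auto
  qed
  show ?thesis
    using separated_if_less[of j k] separated_if_less[of k j] assms by (cases "j < k") auto
qed

lemma inj_on_level2_generator: "inj_on level2_generator (- {0})"
proof (rule inj_onI, rule ccontr)
  fix j k
  assume "j \<in> - {0}" "k \<in> - {0}" "level2_generator j = level2_generator k" "j \<noteq> k"
  then show False
    using centres_level2_generators_separated[of j k] by simp
qed

interpretation level2: schottky_generators "level2_generator ` (- {0})"
proof
  show "level2_generator ` (- {0}) \<subseteq> SL2"
    using level2_generator_SL2 by blast
  show "matrix_inv A \<in> level2_generator ` (- {0})" if "A \<in> level2_generator ` (- {0})" for A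
    using that by (auto simp: matrix_inv_level2_generator)
  show "2 \<le> \<bar>A$2$1\<bar>" if "A \<in> level2_generator ` (- {0})" for A
    using that by (force simp only: level2_generator_lower_left intro: abs_lower_coeff_ge_2)
  show "3/2 \<le> \<bar>centre A - centre B\<bar>"
    if "A \<in> level2_generator ` (- {0})" "B \<in> level2_generator ` (- {0})" "A \<noteq> B" for A B
    using that centres_level2_generators_separated by auto
qed

lemma summable_on_power_abs_int:
  fixes q :: real
  assumes "0 \<le> q" "q < 1"
  shows "(\<lambda>j :: int. q ^ nat \<bar>j\<bar>) summable_on UNIV"
proof -
  have geometric: "(\<lambda>n. q ^ n) summable_on (UNIV :: nat set)"
    using assms by (simp add: summable_on_UNIV_nonneg_real_iff summable_geometric)
  have "(\<lambda>j. q ^ nat \<bar>j\<bar>) summable_on range int"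
    using geometric by (subst summable_on_reindex) (simp_all add: o_def)
  moreover have "(\<lambda>j. q ^ nat \<bar>j\<bar>) summable_on range (\<lambda>n. - int (Suc n))"
    using summable_on_cmult_right[OF geometric, of q]
    by (subst summable_on_reindex) (simp_all add: o_def inj_on_def nat_add_distrib)
  ultimately have "(\<lambda>j. q ^ nat \<bar>j\<bar>) summable_on (range int \<union> range (\<lambda>n. - int (Suc n)))"
    by (rule summable_on_Un_disjoint) auto
  moreover have "j \<in> range int \<union> range (\<lambda>n. - int (Suc n))" for j
    by (rule int_cases[of j]) blast+
  ultimately show ?thesis
    by (metis UNIV_eq_I)
qed

lemma summable_on_level2_generators:
  assumes "0 < s"
  shows "(\<lambda>A. (1 / (A$2$1)\<^sup>2) powr s) summable_on level2_generator ` (- {0})"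
proof -
  define q :: real where "q = (1/4) powr s"
  have "0 \<le> q" "q < 1"
    using assms powr_less_mono2[of s "1/4" 1] by (auto simp: q_def)
  have term_eq: "(1 / (level2_generator j $ 2 $ 1)\<^sup>2) powr s = q ^ nat \<bar>j\<bar>" if "j \<in> - {0}" for j
  proof -
    have "(level2_generator j $ 2 $ 1)\<^sup>2 = (2 ^ nat \<bar>j\<bar>)\<^sup>2"
      using that abs_lower_coeff[of j] by (metis ComplD level2_generator_lower_left insertI1 power2_abs)
    also have "\<dots> = 4 ^ nat \<bar>j\<bar>"
      by (simp add: power2_eq_square flip: power_mult_distrib)
    finally have "1 / (level2_generator j $ 2 $ 1)\<^sup>2 = (1/4) powr real (nat \<bar>j\<bar>)"
      by (simp only: powr_realpow power_one_over)
    then show ?thesis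
      by (simp add: q_def powr_powr powr_power mult.commute)
  qed
  have "(\<lambda>j. q ^ nat \<bar>j\<bar>) summable_on - {0 :: int}"
    using summable_on_power_abs_int[OF \<open>0 \<le> q\<close> \<open>q < 1\<close>] by (rule summable_on_subset_banach) simp
  then have "(\<lambda>j. (1 / (level2_generator j $ 2 $ 1)\<^sup>2) powr s) summable_on - {0}"
    by (rule summable_on_cong[THEN iffD2, rotated]) (rule term_eq)
  then show ?thesis
    by (simp add: summable_on_reindex[OF inj_on_level2_generator] o_def)
qed

theorem theorem2:
  shows "\<exists>G. fuchsian G \<and> torsion_free G \<and> \<not> finitely_generated G \<and>
           (\<forall>x0\<in>uhp. bdry_hausdorff_dim (transient_limit_set G x0) = 0)"
proof (intro exI conjI ballI)
  have congruence: "level2.\<Gamma> \<subseteq> congruence_subgroup_2"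
    by (intro signed_words_subset congruence_subgroup_2_mat_1 congruence_subgroup_2_uminus
          congruence_subgroup_2_mult)
       (auto intro: level2_generator_mem_congruence_subgroup_2)
  show "fuchsian level2.\<Gamma>"
    using level2.psl2_subgroup_\<Gamma> congruence by (rule fuchsian_if_subset_congruence_subgroup_2)
  show "torsion_free level2.\<Gamma>"
    using congruence by (rule torsion_free_if_subset_congruence_subgroup_2)
  show "\<not> finitely_generated level2.\<Gamma>"
    using finite_imageD[OF _ inj_on_level2_generator]
    by (intro level2.not_finitely_generated_\<Gamma>) (auto simp: infinite_UNIV_int)
  show "bdry_hausdorff_dim (transient_limit_set level2.\<Gamma> x0) = 0" if "x0 \<in> uhp" for x0
    using summable_on_level2_generators that by (rule level2.bdry_hausdorff_dim_transient_limit_set)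
qed

end
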